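(* Let $m,n\in\mathbb N$, $\delta\in\{\pm1\}$, $\lambda\in\mathbb C\setminus\{0\}$, and regard $(L_m\otimes L_n)^{\delta,\lambda}$ as an $\mathcal H_q$-module via $\widetilde\natural$. For $\theta\in\mathbb C$ let $(L_m\otimes L_n)^{\delta,\lambda}(\theta)$ be the $\theta$-eigenspace of $K_1K_2$. Then: (i) $(L_m\otimes L_n)^{\delta,\lambda}=\bigoplus_{\ell=0}^{m+n}(L_m\otimes L_n)^{\delta,\lambda}(\delta q^{m+n-2\ell})$, and each summand is an $\mathcal H_q$-submodule; (ii) for each integer $0\le\ell\le m+n$, the $\mathcal H_q$-module $(L_m\otimes L_n)^{\delta,\lambda}(\delta q^{m+n-2\ell})$ is isomorphic to the irreducible $\mathcal H_q$-module $V_d(a,b,c)$, where $a=\delta\lambda q^{\ell-n-\min\{m,\ell\}+\min\{n,\ell\}}$, $b=\delta q^{m+n+\ell-\min\{m,\ell\}-\min\{n,\ell\}+1}$, $c=\lambda q^{\ell-m-\min\{n,\ell\}+\min\{m,\ell\}}$, $d=\min\{m,\ell\}+\min\{n,\ell\}-\ell$.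
   Context: Throughout, $q$ is a nonzero complex number that is not a root of unity; $[x,y]=xy-yx$, $[x,y]_q=qxy-q^{-1}yx$, $[n]_q=\frac{q^n-q^{-n}}{q-q^{-1}}$. $\mathfrak{W}_q$ is the algebra over $\mathbb C$ generated by $E_1,E_2,F_1,F_2,K_1^{\pm1},K_2^{\pm1},I^{\pm1}$ subject to: $I$ is central; $II^{-1}=I^{-1}I=1$, $K_1K_1^{-1}=K_1^{-1}K_1=1$, $K_2K_2^{-1}=K_2^{-1}K_2=1$; $[K_1,E_2]=[K_1,F_2]=[K_1,K_2]=[K_2,E_1]=[K_2,F_1]=0$; $[E_1,K_1]_q=[K_1,F_1]_q=[E_2,K_2]_q=[K_2,F_2]_q=0$; $[E_1,E_2]=[E_1,F_2]=[F_1,E_2]=[F_1,F_2]=0$; $[E_1,F_1]=\frac{K_1-IK_1^{-1}}{q-q^{-1}}$; $[E_2,F_2]=\frac{IK_2-K_2^{-1}}{q-q^{-1}}$. The universal $q$-Hahn algebra $\mathcal H_q$ is the algebra generated by $A,B,C$ subject to the relations that each of $\frac{[B,C]_q}{q^2-q^{-2}}+A$, $[C,A]_q$, $\frac{[A,B]_q}{q^2-q^{-2}}+C$ commutes with $A,B,C$. $\widetilde\natural:\mathcal H_q\to\mathfrak{W}_q$ is the algebra homomorphism with $A\mapsto K_2^{-1}$, $B\mapsto (q-q^{-1})^2(E_1+K_1^{-1}E_2)(F_1K_2+F_2)+q^{-1}K_1K_2+qK_1^{-1}K_2^{-1}$, $C\mapsto IK_1^{-1}-q(q-q^{-1})^2E_1F_2K_2^{-1}$.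 $(L_m\otimes L_n)^{\delta,\lambda}$ is the $\mathfrak{W}_q$-module with basis $v_i^{(m)}\otimes v_j^{(n)}$ ($0\le i\le m$, $0\le j\le n$) on which: $E_1v_i^{(m)}\otimes v_j^{(n)}=\lambda[i]_q[m-i+1]_qv_{i-1}^{(m)}\otimes v_j^{(n)}$ (zero if $i=0$); $E_2v_i^{(m)}\otimes v_j^{(n)}=\delta\lambda[j]_q[n-j+1]_qv_i^{(m)}\otimes v_{j-1}^{(n)}$ (zero if $j=0$); $F_1v_i^{(m)}\otimes v_j^{(n)}=v_{i+1}^{(m)}\otimes v_j^{(n)}$ (zero if $i=m$); $F_2v_i^{(m)}\otimes v_j^{(n)}=v_i^{(m)}\otimes v_{j+1}^{(n)}$ (zero if $j=n$); $K_1$ acts by $\lambda q^{m-2i}$, $K_2$ by $\delta\lambda^{-1}q^{n-2j}$, $I$ by $\lambda^2$. For $a,c\in\mathbb C$, $b\ne0$, $d\in\mathbb N$, with $\nu=q^d$, $\theta_i=a\nu q^{-2i}$, $\theta_i^*=b\nu q^{-2i}+b^{-1}\nu^{-1}q^{2i}$, $\theta_i^\varepsilon=c\nu^{-1}q^{2i}$, $\varphi_i=(q^i-q^{-i})(\nu q^{1-i}-\nu^{-1}q^{i-1})(c-ab\nu q^{1-2i})$, $\varphi_i^\varepsilon=(q^i-q^{-i})(\nu q^{1-i}-\nu^{-1}q^{i-1})(a-b^{-1}c\nu^{-1}q^{2i-1})$, $V_d(a,b,c)$ is the $\mathcal H_q$-module with basis $m_0,\dots,m_d$ where $(A-\theta_0)m_0=0$,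 $(A-\theta_i)m_i=\varphi_im_{i-1}$ ($1\le i\le d$); $(B-\theta_i^* )m_i=m_{i+1}$ ($0\le i<d$), $(B-\theta_d^* )m_d=0$; $(C-\theta_0^\varepsilon)m_0=0$, $(C-\theta_i^\varepsilon)m_i=\varphi_i^\varepsilon m_{i-1}$ ($1\le i\le d$). *)

theory Defs
  imports Complex_Main
begin

definition qint :: "complex \<Rightarrow> int \<Rightarrow> complex" where
  "qint q k = (q powi k - q powi (-k)) / (q - inverse q)"

text \<open>A vector is a coefficient function on basis indices (i,j), with
  support in {0..m} x {0..n}; x(i,j) is the coefficient of v_i^(m) tensor v_j^(n).\<close>

type_synonym tvec = "nat \<times> nat \<Rightarrow> complex"

definition tens_space :: "nat \<Rightarrow> nat \<Rightarrow> tvec set" where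
  "tens_space m n = {x. \<forall>i j. (m < i \<or> n < j) \<longrightarrow> x (i, j) = 0}"

definition E1op :: "complex \<Rightarrow> nat \<Rightarrow> nat \<Rightarrow> complex \<Rightarrow> complex \<Rightarrow> tvec \<Rightarrow> tvec" where
  "E1op q m n \<delta> lam x = (\<lambda>(i, j). if i < m \<and> j \<le> n
      then lam * qint q (int i + 1) * qint q (int m - int i) * x (i + 1, j) else 0)"

definition E2op :: "complex \<Rightarrow> nat \<Rightarrow> nat \<Rightarrow> complex \<Rightarrow> complex \<Rightarrow> tvec \<Rightarrow> tvec" where
  "E2op q m n \<delta> lam x = (\<lambda>(i, j). if i \<le> m \<and> j < n
      then \<delta> * lam * qint q (int j + 1) * qint q (int n - int j) * x (i, j + 1) else 0)"

definition F1op :: "complex \<Rightarrow> nat \<Rightarrow> nat \<Rightarrow> complex \<Rightarrow> complex \<Rightarrow> tvec \<Rightarrow> tvec" where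
  "F1op q m n \<delta> lam x = (\<lambda>(i, j). if 0 < i \<and> i \<le> m \<and> j \<le> n then x (i - 1, j) else 0)"

definition F2op :: "complex \<Rightarrow> nat \<Rightarrow> nat \<Rightarrow> complex \<Rightarrow> complex \<Rightarrow> tvec \<Rightarrow> tvec" where
  "F2op q m n \<delta> lam x = (\<lambda>(i, j). if i \<le> m \<and> 0 < j \<and> j \<le> n then x (i, j - 1) else 0)"

definition K1op :: "complex \<Rightarrow> nat \<Rightarrow> nat \<Rightarrow> complex \<Rightarrow> complex \<Rightarrow> tvec \<Rightarrow> tvec" where
  "K1op q m n \<delta> lam x = (\<lambda>(i, j). if i \<le> m \<and> j \<le> n
      then lam * q powi (int m - 2 * int i) * x (i, j) else 0)"

definition K1invop :: "complex \<Rightarrow> nat \<Rightarrow> nat \<Rightarrow> complex \<Rightarrow> complex \<Rightarrow> tvec \<Rightarrow> tvec" where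
  "K1invop q m n \<delta> lam x = (\<lambda>(i, j). if i \<le> m \<and> j \<le> n
      then inverse lam * q powi (- (int m - 2 * int i)) * x (i, j) else 0)"

definition K2op :: "complex \<Rightarrow> nat \<Rightarrow> nat \<Rightarrow> complex \<Rightarrow> complex \<Rightarrow> tvec \<Rightarrow> tvec" where
  "K2op q m n \<delta> lam x = (\<lambda>(i, j). if i \<le> m \<and> j \<le> n
      then \<delta> * inverse lam * q powi (int n - 2 * int j) * x (i, j) else 0)"

definition K2invop :: "complex \<Rightarrow> nat \<Rightarrow> nat \<Rightarrow> complex \<Rightarrow> complex \<Rightarrow> tvec \<Rightarrow> tvec" where
  "K2invop q m n \<delta> lam x = (\<lambda>(i, j). if i \<le> m \<and> j \<le> n
      then inverse (\<delta> * inverse lam) * q powi (- (int n - 2 * int j)) * x (i, j) else 0)"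

definition Iop :: "complex \<Rightarrow> nat \<Rightarrow> nat \<Rightarrow> complex \<Rightarrow> complex \<Rightarrow> tvec \<Rightarrow> tvec" where
  "Iop q m n \<delta> lam x = (\<lambda>(i, j). if i \<le> m \<and> j \<le> n then lam ^ 2 * x (i, j) else 0)"

text \<open>Images of the generators A, B, C of H_q under the homomorphism natural-tilde.\<close>

definition HAop :: "complex \<Rightarrow> nat \<Rightarrow> nat \<Rightarrow> complex \<Rightarrow> complex \<Rightarrow> tvec \<Rightarrow> tvec" where
  "HAop q m n \<delta> lam x = K2invop q m n \<delta> lam x"

definition HBop :: "complex \<Rightarrow> nat \<Rightarrow> nat \<Rightarrow> complex \<Rightarrow> complex \<Rightarrow> tvec \<Rightarrow> tvec" where
  "HBop q m n \<delta> lam x = (\<lambda>p.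
      (q - inverse q) ^ 2 *
        ( E1op q m n \<delta> lam (F1op q m n \<delta> lam (K2op q m n \<delta> lam x)) p
        + E1op q m n \<delta> lam (F2op q m n \<delta> lam x) p
        + K1invop q m n \<delta> lam (E2op q m n \<delta> lam (F1op q m n \<delta> lam (K2op q m n \<delta> lam x))) p
        + K1invop q m n \<delta> lam (E2op q m n \<delta> lam (F2op q m n \<delta> lam x)) p)
      + inverse q * K1op q m n \<delta> lam (K2op q m n \<delta> lam x) p
      + q * K1invop q m n \<delta> lam (K2invop q m n \<delta> lam x) p)"

definition HCop :: "complex \<Rightarrow> nat \<Rightarrow> nat \<Rightarrow> complex \<Rightarrow> complex \<Rightarrow> tvec \<Rightarrow> tvec" where
  "HCop q m n \<delta> lam x = (\<lambda>p.
      Iop q m n \<delta> lam (K1invop q m n \<delta> lam x) p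
      - q * (q - inverse q) ^ 2 *
        E1op q m n \<delta> lam (F2op q m n \<delta> lam (K2invop q m n \<delta> lam x)) p)"

definition K1K2_eigenspace ::
  "complex \<Rightarrow> nat \<Rightarrow> nat \<Rightarrow> complex \<Rightarrow> complex \<Rightarrow> complex \<Rightarrow> tvec set" where
  "K1K2_eigenspace q m n \<delta> lam \<theta> =
     {x \<in> tens_space m n. K1op q m n \<delta> lam (K2op q m n \<delta> lam x) = (\<lambda>p. \<theta> * x p)}"

text \<open>A vector is y :: nat => complex with support in {0..d};
  y k is the coefficient of m_k.\<close>

definition Vspace :: "nat \<Rightarrow> (nat \<Rightarrow> complex) set" where
  "Vspace d = {y. \<forall>k. d < k \<longrightarrow> y k = 0}"

definition hth :: "complex \<Rightarrow> complex \<Rightarrow> nat \<Rightarrow> nat \<Rightarrow> complex" where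
  "hth q a d i = a * q ^ d * q powi (- 2 * int i)"

definition hths :: "complex \<Rightarrow> complex \<Rightarrow> nat \<Rightarrow> nat \<Rightarrow> complex" where
  "hths q b d i = b * q ^ d * q powi (- 2 * int i) + inverse b * inverse (q ^ d) * q powi (2 * int i)"

definition hthe :: "complex \<Rightarrow> complex \<Rightarrow> nat \<Rightarrow> nat \<Rightarrow> complex" where
  "hthe q c d i = c * inverse (q ^ d) * q powi (2 * int i)"

definition hphi :: "complex \<Rightarrow> complex \<Rightarrow> complex \<Rightarrow> complex \<Rightarrow> nat \<Rightarrow> nat \<Rightarrow> complex" where
  "hphi q a b c d i = (q powi int i - q powi (- int i))
      * (q ^ d * q powi (1 - int i) - inverse (q ^ d) * q powi (int i - 1))
      * (c - a * b * q ^ d * q powi (1 - 2 * int i))"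

definition hphie :: "complex \<Rightarrow> complex \<Rightarrow> complex \<Rightarrow> complex \<Rightarrow> nat \<Rightarrow> nat \<Rightarrow> complex" where
  "hphie q a b c d i = (q powi int i - q powi (- int i))
      * (q ^ d * q powi (1 - int i) - inverse (q ^ d) * q powi (int i - 1))
      * (a - inverse b * c * inverse (q ^ d) * q powi (2 * int i - 1))"

text \<open>A m_i = theta_i m_i + phi_i m_{i-1};  B m_i = theta*_i m_i + m_{i+1};
  C m_i = theta^eps_i m_i + phi^eps_i m_{i-1}, written in coordinates.\<close>

definition VAop :: "complex \<Rightarrow> complex \<Rightarrow> complex \<Rightarrow> complex \<Rightarrow> nat \<Rightarrow> (nat \<Rightarrow> complex) \<Rightarrow> nat \<Rightarrow> complex" where
  "VAop q a b c d y = (\<lambda>k. if k \<le> d then hth q a d k * y k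
      + (if k < d then hphi q a b c d (k + 1) * y (k + 1) else 0) else 0)"

definition VBop :: "complex \<Rightarrow> complex \<Rightarrow> complex \<Rightarrow> complex \<Rightarrow> nat \<Rightarrow> (nat \<Rightarrow> complex) \<Rightarrow> nat \<Rightarrow> complex" where
  "VBop q a b c d y = (\<lambda>k. if k \<le> d then hths q b d k * y k
      + (if 0 < k then y (k - 1) else 0) else 0)"

definition VCop :: "complex \<Rightarrow> complex \<Rightarrow> complex \<Rightarrow> complex \<Rightarrow> nat \<Rightarrow> (nat \<Rightarrow> complex) \<Rightarrow> nat \<Rightarrow> complex" where
  "VCop q a b c d y = (\<lambda>k. if k \<le> d then hthe q c d k * y k
      + (if k < d then hphie q a b c d (k + 1) * y (k + 1) else 0) else 0)"

definition Vd_irreducible :: "complex \<Rightarrow> complex \<Rightarrow> complex \<Rightarrow> complex \<Rightarrow> nat \<Rightarrow> bool" where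
  "Vd_irreducible q a b c d \<longleftrightarrow>
     (\<forall>U. U \<subseteq> Vspace d \<and> (\<lambda>_. 0) \<in> U
        \<and> (\<forall>y\<in>U. \<forall>z\<in>U. (\<lambda>k. y k + z k) \<in> U)
        \<and> (\<forall>y\<in>U. \<forall>s. (\<lambda>k. s * y k) \<in> U)
        \<and> (\<forall>y\<in>U. VAop q a b c d y \<in> U \<and> VBop q a b c d y \<in> U \<and> VCop q a b c d y \<in> U)
      \<longrightarrow> U = {\<lambda>_. 0} \<or> U = Vspace d)"

definition Hq_iso_to_Vd ::
  "complex \<Rightarrow> nat \<Rightarrow> nat \<Rightarrow> complex \<Rightarrow> complex \<Rightarrow> tvec set
     \<Rightarrow> complex \<Rightarrow> complex \<Rightarrow> complex \<Rightarrow> nat \<Rightarrow> bool" where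
  "Hq_iso_to_Vd q m n \<delta> lam W a b c d \<longleftrightarrow>
     (\<exists>f. bij_betw f W (Vspace d)
        \<and> (\<forall>x\<in>W. \<forall>y\<in>W. f (\<lambda>p. x p + y p) = (\<lambda>k. f x k + f y k))
        \<and> (\<forall>x\<in>W. \<forall>s. f (\<lambda>p. s * x p) = (\<lambda>k. s * f x k))
        \<and> (\<forall>x\<in>W. f (HAop q m n \<delta> lam x) = VAop q a b c d (f x)
                 \<and> f (HBop q m n \<delta> lam x) = VBop q a b c d (f x)
                 \<and> f (HCop q m n \<delta> lam x) = VCop q a b c d (f x)))"

end

theory Submission
  imports Defs
begin

text \<open>
  Put \<open>J = min n l\<close>, \<open>r = l - J\<close>, \<open>p = n - J\<close>, \<open>M = m - r\<close>; then \<open>r = 0\<close> or \<open>p = 0\<close>, and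
  \<open>d = min J M\<close>. The weight space with index \<open>l\<close> has the basis
  \<open>u_s = v_(r+s) \<otimes> v_(J-s)\<close>, \<open>0 \<le> s \<le> d\<close>. In it \<open>A\<close> is diagonal with distinct eigenvalues \<open>\<theta> s\<close>, \<open>C\<close> is
  bidiagonal and \<open>B\<close> is tridiagonal with nonvanishing off-diagonal entries, whence irreducibility.
  The isomorphism sends \<open>m_k\<close> to \<open>\<Sum>s\<le>k. P k s * u_s\<close>. The relation for \<open>A\<close> forces
  \<open>P k s = P (k - 1) s * \<phi> k / (\<theta> s - \<theta> k)\<close> and the leading term of the relation for \<open>B\<close> forces
  \<open>P s s = \<Prod>t<s. \<beta> t\<close>. All ratios of neighbouring entries are then explicit, and the relations for
  \<open>B\<close> and \<open>C\<close> reduce to one Laurent polynomial identity each.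
\<close>

section \<open>Tridiagonal operators and triangular changes of basis\<close>

text \<open>All weights are indexed by their source: the basis vector with index \<open>s\<close>
  goes to \<open>\<alpha> s\<close> times itself, plus \<open>\<beta> s\<close> times its successor,
  plus \<open>\<gamma> s\<close> times its predecessor.\<close>

definition tridiag :: "nat \<Rightarrow> (nat \<Rightarrow> complex) \<Rightarrow> (nat \<Rightarrow> complex) \<Rightarrow> (nat \<Rightarrow> complex) \<Rightarrow> (nat \<Rightarrow> complex) \<Rightarrow> nat \<Rightarrow> complex" where
  "tridiag d \<alpha> \<beta> \<gamma> z = (\<lambda>s. if s \<le> d then \<alpha> s * z s
      + (if 0 < s then \<beta> (s - 1) * z (s - 1) else 0)
      + (if s < d then \<gamma> (s + 1) * z (s + 1) else 0) else 0)"

lemma VAop_eq_tridiag: "VAop q a b c d = tridiag d (hth q a d) (\<lambda>_. 0) (hphi q a b c d)"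
  by (auto simp: VAop_def tridiag_def fun_eq_iff)

lemma VBop_eq_tridiag: "VBop q a b c d = tridiag d (hths q b d) (\<lambda>_. 1) (\<lambda>_. 0)"
  by (auto simp: VBop_def tridiag_def fun_eq_iff)

lemma VCop_eq_tridiag: "VCop q a b c d = tridiag d (hthe q c d) (\<lambda>_. 0) (hphie q a b c d)"
  by (auto simp: VCop_def tridiag_def fun_eq_iff)

lemma tridiag_in_Vspace: "tridiag d \<alpha> \<beta> \<gamma> z \<in> Vspace d"
  by (auto simp: tridiag_def Vspace_def)

text \<open>Row \<open>k\<close> of \<open>c\<close> lists the old coordinates of the
  \<open>k\<close>-th new basis vector, so this map turns new coordinates \<open>y\<close> into old
  ones.\<close>

definition row_comb :: "nat \<Rightarrow> (nat \<Rightarrow> nat \<Rightarrow> complex) \<Rightarrow> (nat \<Rightarrow> complex) \<Rightarrow> nat \<Rightarrow> complex" where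
  "row_comb d c y = (\<lambda>s. if s \<le> d then \<Sum>k\<le>d. y k * c k s else 0)"

lemma row_comb_in_Vspace: "row_comb d c y \<in> Vspace d"
  by (auto simp: row_comb_def Vspace_def)

lemma row_comb_add: "row_comb d c (\<lambda>k. y k + z k) = (\<lambda>s. row_comb d c y s + row_comb d c z s)"
  by (auto simp: row_comb_def fun_eq_iff algebra_simps sum.distrib)

lemma row_comb_scale: "row_comb d c (\<lambda>k. r * y k) = (\<lambda>s. r * row_comb d c y s)"
  by (auto simp: row_comb_def fun_eq_iff algebra_simps sum_distrib_left)

lemma row_comb_zero: "row_comb d c (\<lambda>_. 0) = (\<lambda>_. 0)"
  by (auto simp: row_comb_def fun_eq_iff)

lemma row_comb_diff: "row_comb d c (\<lambda>k. y k - z k) = (\<lambda>s. row_comb d c y s - row_comb d c z s)"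
  by (auto simp: row_comb_def fun_eq_iff algebra_simps sum_subtractf)

text \<open>Column \<open>t\<close> of a lower triangular matrix meets only rows
  \<open>k \<ge> t\<close>, so a kernel vector vanishes coordinate by coordinate, from index
  \<open>d\<close> downwards.\<close>

lemma inj_on_row_comb:
  assumes upper: "\<And>k s. k < s \<Longrightarrow> c k s = 0" and diag: "\<And>k. k \<le> d \<Longrightarrow> c k k \<noteq> 0"
  shows "inj_on (row_comb d c) (Vspace d)"
proof (rule inj_onI)
  fix y z assume y: "y \<in> Vspace d" and z: "z \<in> Vspace d" and eq: "row_comb d c y = row_comb d c z"
  define w where "w = (\<lambda>k. y k - z k)"
  have w: "w \<in> Vspace d" using y z by (auto simp: w_def Vspace_def)
  have w0: "row_comb d c w = (\<lambda>_. 0)"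
    unfolding w_def row_comb_diff by (simp add: eq)
  have "w t = 0" for t
  proof (cases "t \<le> d")
    case True
    then show ?thesis
    proof (induction "d - t" arbitrary: t rule: less_induct)
      case less
      have above: "w k = 0" if "t < k" for k
      proof (cases "k \<le> d")
        case True
        with that less.prems show ?thesis by (intro less.hyps) auto
      next
        case False then show ?thesis using w by (auto simp: Vspace_def)
      qed
      have "0 = (\<Sum>k\<le>d. w k * c k t)"
        using fun_cong[OF w0, of t] less.prems by (simp add: row_comb_def)
      also have "\<dots> = (\<Sum>k\<in>{t}. w k * c k t)"
      proof (rule sum.mono_neutral_right)
        show "\<forall>k\<in>{..d} - {t}. w k * c k t = 0"
        proof
          fix k assume "k \<in> {..d} - {t}"
          then have "k < t \<or> t < k" by auto
          then show "w k * c k t = 0" using above[of k] upper[of k t] by auto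
        qed
      qed (use less.prems in auto)
      finally show ?case using diag[OF less.prems] by simp
    qed
  next
    case False then show ?thesis using w by (auto simp: Vspace_def)
  qed
  then show "y = z" by (auto simp: w_def fun_eq_iff)
qed

lemma row_comb_surj:
  assumes upper: "\<And>k s. k < s \<Longrightarrow> c k s = 0" and diag: "\<And>k. k \<le> d \<Longrightarrow> c k k \<noteq> 0"
    and x: "x \<in> Vspace d"
  shows "x \<in> row_comb d c ` Vspace d"
proof -
  \<comment> \<open>The induction runs over a bound \<open>t\<close> for the support of
    \<open>x\<close>; starting it at \<open>Suc d\<close> covers all of
    \<open>Vspace d\<close>.\<close>
  have "x \<in> row_comb d c ` Vspace d" if "t \<le> Suc d" and "\<forall>s\<ge>t. x s = 0" for x t
    using that
  proof (induction t arbitrary: x)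
    case 0
    then have "x = row_comb d c (\<lambda>_. 0)" by (auto simp: row_comb_zero)
    then show ?case by (auto simp: Vspace_def)
  next
    case (Suc t)
    then have td: "t \<le> d" by simp
    \<comment> \<open>This multiple of row \<open>t\<close> has the same top entry as
      \<open>x\<close>, so subtracting it shortens the support.\<close>
    define r where "r = x t / c t t"
    define e where "e = (\<lambda>k. if k = t then r else 0)"
    have e: "row_comb d c e s = (if s \<le> d then r * c t s else 0)" for s
      using td by (simp add: row_comb_def e_def if_distrib[of "\<lambda>u. u * _"] cong: if_cong)
    have "x s - row_comb d c e s = 0" if "t \<le> s" for s
    proof (cases "s = t")
      case True then show ?thesis using td diag by (simp add: e r_def)
    next
      case False with that Suc.prems upper[of t s] show ?thesis by (simp add: e)
    qed
    then have "(\<lambda>s. x s - row_comb d c e s) \<in> row_comb d c ` Vspace d"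
      using td by (intro Suc.IH) auto
    then obtain y where y: "y \<in> Vspace d" "(\<lambda>s. x s - row_comb d c e s) = row_comb d c y" by auto
    have "x = row_comb d c (\<lambda>k. y k + e k)"
      unfolding row_comb_add y(2)[symmetric] by simp
    moreover have "(\<lambda>k. y k + e k) \<in> Vspace d" using y td by (auto simp: Vspace_def e_def)
    ultimately show ?case by auto
  qed
  from this[of "Suc d" x] x show ?thesis by (auto simp: Vspace_def)
qed

lemma bij_betw_row_comb:
  assumes "\<And>k s. k < s \<Longrightarrow> c k s = 0" and "\<And>k. k \<le> d \<Longrightarrow> c k k \<noteq> 0"
  shows "bij_betw (row_comb d c) (Vspace d) (Vspace d)"
  unfolding bij_betw_def
  using inj_on_row_comb[of c d] row_comb_surj[of c d] assms row_comb_in_Vspace[of d c] by blast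

lemma sum_shift_down:
  fixes u w :: "nat \<Rightarrow> complex"
  shows "(\<Sum>k\<le>d. (if 0 < k then u (k - 1) else 0) * w k) = (\<Sum>k\<le>d. if k < d then u k * w (Suc k) else 0)"
proof -
  have "(\<Sum>k\<le>d. (if 0 < k then u (k - 1) else 0) * w k) = (\<Sum>k<d. u k * w (Suc k))"
    by (induction d) auto
  also have "\<dots> = (\<Sum>k\<le>d. if k < d then u k * w (Suc k) else 0)"
    by (simp add: lessThan_Suc_atMost[symmetric])
  finally show ?thesis .
qed

text \<open>The hypothesis compares, coordinate by coordinate, the two images of the
  \<open>k\<close>-th new basis vector. Shifting the index in the off-diagonal sums collects all
  terms with the common factor \<open>y k\<close>, which extends this to every
  \<open>y\<close>.\<close>

lemma row_comb_tridiag: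
  assumes "\<And>k s. k \<le> d \<Longrightarrow> s \<le> d \<Longrightarrow>
      \<alpha>' k * c k s + (if k < d then \<beta>' k * c (k + 1) s else 0) + (if 0 < k then \<gamma>' k * c (k - 1) s else 0)
    = \<alpha> s * c k s + (if 0 < s then \<beta> (s - 1) * c k (s - 1) else 0) + (if s < d then \<gamma> (s + 1) * c k (s + 1) else 0)"
  shows "row_comb d c (tridiag d \<alpha>' \<beta>' \<gamma>' y) = tridiag d \<alpha> \<beta> \<gamma> (row_comb d c y)"
proof
  fix s
  show "row_comb d c (tridiag d \<alpha>' \<beta>' \<gamma>' y) s = tridiag d \<alpha> \<beta> \<gamma> (row_comb d c y) s"
  proof (cases "s \<le> d")
    case True
    have "row_comb d c (tridiag d \<alpha>' \<beta>' \<gamma>' y) s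
      = (\<Sum>k\<le>d. \<alpha>' k * y k * c k s)
        + (\<Sum>k\<le>d. (if 0 < k then \<beta>' (k - 1) * y (k - 1) else 0) * c k s)
        + (\<Sum>k\<le>d. if k < d then c k s * (\<gamma>' (Suc k) * y (Suc k)) else 0)"
      using True by (auto simp: row_comb_def tridiag_def sum.distrib[symmetric] algebra_simps intro!: sum.cong)
    also have "\<dots> = (\<Sum>k\<le>d. \<alpha>' k * y k * c k s)
        + (\<Sum>k\<le>d. if k < d then \<beta>' k * y k * c (Suc k) s else 0)
        + (\<Sum>k\<le>d. (if 0 < k then c (k - 1) s else 0) * (\<gamma>' k * y k))"
      by (simp only: sum_shift_down[where u = "\<lambda>k. \<beta>' k * y k" and w = "\<lambda>k. c k s"]
          sum_shift_down[where u = "\<lambda>k. c k s" and w = "\<lambda>k. \<gamma>' k * y k"])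
    also have "\<dots> = (\<Sum>k\<le>d. y k * (\<alpha>' k * c k s + (if k < d then \<beta>' k * c (k + 1) s else 0)
        + (if 0 < k then \<gamma>' k * c (k - 1) s else 0)))"
      by (auto simp: sum.distrib[symmetric] algebra_simps intro!: sum.cong)
    also have "\<dots> = (\<Sum>k\<le>d. y k * (\<alpha> s * c k s + (if 0 < s then \<beta> (s - 1) * c k (s - 1) else 0)
        + (if s < d then \<gamma> (s + 1) * c k (s + 1) else 0)))"
      using assms True by (intro sum.cong) auto
    also have "\<dots> = tridiag d \<alpha> \<beta> \<gamma> (row_comb d c y) s"
      using True by (auto simp: row_comb_def tridiag_def sum.distrib[symmetric] algebra_simps sum_distrib_left)
    finally show ?thesis .
  qed (simp add: row_comb_def tridiag_def)
qed

section \<open>Invariant subspaces of tridiagonal operators\<close>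

definition Vsubspace :: "nat \<Rightarrow> (nat \<Rightarrow> complex) set \<Rightarrow> bool" where
  "Vsubspace d U \<longleftrightarrow> U \<subseteq> Vspace d \<and> (\<lambda>_. 0) \<in> U
        \<and> (\<forall>y\<in>U. \<forall>z\<in>U. (\<lambda>k. y k + z k) \<in> U)
        \<and> (\<forall>y\<in>U. \<forall>s. (\<lambda>k. s * y k) \<in> U)"

lemma Vsubspace_add: "Vsubspace d U \<Longrightarrow> y \<in> U \<Longrightarrow> z \<in> U \<Longrightarrow> (\<lambda>k. y k + z k) \<in> U"
  by (simp add: Vsubspace_def)

lemma Vsubspace_scale: "Vsubspace d U \<Longrightarrow> y \<in> U \<Longrightarrow> (\<lambda>k. r * y k) \<in> U"
  by (simp add: Vsubspace_def)

text \<open>Lagrange interpolation: applying the factors \<open>A - \<theta> t\<close> for all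
  \<open>t \<noteq> s\<close> isolates the component of \<open>z\<close> at \<open>s\<close>, which
  survives because the eigenvalues are distinct.\<close>

lemma Vsubspace_diag_separates:
  assumes U: "Vsubspace d U"
    and A: "\<And>z. z \<in> U \<Longrightarrow> tridiag d \<theta> (\<lambda>_. 0) (\<lambda>_. 0) z \<in> U"
    and dist: "inj_on \<theta> {..d}"
    and z: "z \<in> U" "z s \<noteq> 0" and s: "s \<le> d"
  shows "(\<lambda>t. if t = s then 1 else 0) \<in> U"
proof -
  have "\<exists>w\<in>U. w s \<noteq> 0 \<and> (\<forall>t\<in>F. w t = 0)" if "finite F" "F \<subseteq> {..d} - {s}" for F
    using that
  proof (induction F rule: finite_induct)
    case empty then show ?case using z by auto
  next
    case (insert t F)
    then obtain w where w: "w \<in> U" "w s \<noteq> 0" "\<forall>t\<in>F. w t = 0" by auto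
    \<comment> \<open>This is \<open>A - \<theta> t\<close> applied to \<open>w\<close>: it kills
      coordinate \<open>t\<close>, keeps the zeros already made, and scales coordinate
      \<open>s\<close> by a nonzero number.\<close>
    define w' where "w' = (\<lambda>k. tridiag d \<theta> (\<lambda>_. 0) (\<lambda>_. 0) w k + (- \<theta> t) * w k)"
    have "w' \<in> U" unfolding w'_def
      by (intro Vsubspace_add[OF U] Vsubspace_scale[OF U] A w(1))
    moreover have "w' k = (\<theta> k - \<theta> t) * w k" if "k \<le> d" for k
      using that by (simp add: w'_def tridiag_def algebra_simps)
    moreover have "\<theta> s \<noteq> \<theta> t" using dist s insert.prems by (auto simp: inj_on_def)
    ultimately show ?case using w s insert.prems by (intro bexI[of _ w']) auto
  qed
  from this[of "{..d} - {s}"] obtain w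
    where w: "w \<in> U" "w s \<noteq> 0" "\<forall>t\<in>{..d} - {s}. w t = 0" by auto
  have "w t = 0" if "t \<noteq> s" for t
    using that w U by (cases "t \<le> d") (auto simp: Vsubspace_def Vspace_def)
  then have "(\<lambda>t. if t = s then 1 else 0) = (\<lambda>k. inverse (w s) * w k)"
    using w by (auto simp: fun_eq_iff)
  also have "\<dots> \<in> U" using U w by (auto simp: Vsubspace_def)
  finally show ?thesis .
qed

lemma Vsubspace_eq_Vspace:
  assumes U: "Vsubspace d U" and e: "\<And>s. s \<le> d \<Longrightarrow> (\<lambda>t. if t = s then 1 else 0) \<in> U"
  shows "U = Vspace d"
proof -
  have "x \<in> U" if "t \<le> Suc d" "\<forall>s\<ge>t. x s = 0" for t x
    using that
  proof (induction t arbitrary: x)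
    case 0
    then have "x = (\<lambda>_. 0)" by auto
    then show ?case using U by (simp add: Vsubspace_def)
  next
    case (Suc t)
    define y where "y = x(t := 0)"
    have "y \<in> U" using Suc.prems by (intro Suc.IH) (auto simp: y_def le_Suc_eq not_less_eq_eq)
    moreover have "(\<lambda>k. x t * (if k = t then 1 else 0)) \<in> U"
      using e[of t] Suc.prems U by (auto simp: Vsubspace_def)
    ultimately have "(\<lambda>k. y k + x t * (if k = t then 1 else 0)) \<in> U"
      by (rule Vsubspace_add[OF U])
    also have "(\<lambda>k. y k + x t * (if k = t then 1 else 0)) = x"
      by (auto simp: y_def fun_eq_iff)
    finally show ?case .
  qed
  from this[of "Suc d"] U show ?thesis by (auto simp: Vsubspace_def Vspace_def)
qed

text \<open>A nonzero vector of \<open>U\<close> yields one unit vector by separation. The image of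
  a unit vector under the second operator has nonzero entries at both neighbours, so separation
  again reaches first index 0 and then every index.\<close>

lemma tridiag_irreducible:
  assumes U: "Vsubspace d U"
    and A: "\<And>z. z \<in> U \<Longrightarrow> tridiag d \<theta> (\<lambda>_. 0) (\<lambda>_. 0) z \<in> U"
    and B: "\<And>z. z \<in> U \<Longrightarrow> tridiag d \<alpha> \<beta> \<gamma> z \<in> U"
    and dist: "inj_on \<theta> {..d}"
    and \<beta>: "\<And>s. s < d \<Longrightarrow> \<beta> s \<noteq> 0" and \<gamma>: "\<And>s. s < d \<Longrightarrow> \<gamma> (s + 1) \<noteq> 0"
  shows "U = {\<lambda>_. 0} \<or> U = Vspace d"
proof (cases "U = {\<lambda>_. 0}")
  case False
  let ?e = "\<lambda>s t. if t = s then 1 else (0 :: complex)"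
  have sep: "?e s \<in> U" if "z \<in> U" "z s \<noteq> 0" "s \<le> d" for z s
    by (rule Vsubspace_diag_separates[OF U _ dist that]) (rule A)
  have up: "?e (Suc s) \<in> U" if es: "?e s \<in> U" and s: "s < d" for s
  proof (rule sep)
    show "tridiag d \<alpha> \<beta> \<gamma> (?e s) \<in> U" by (rule B[OF es])
    show "tridiag d \<alpha> \<beta> \<gamma> (?e s) (Suc s) \<noteq> 0" using s \<beta>[OF s] by (simp add: tridiag_def)
  qed (use s in simp)
  have down: "?e s \<in> U" if es: "?e (Suc s) \<in> U" and s: "s < d" for s
  proof (rule sep)
    show "tridiag d \<alpha> \<beta> \<gamma> (?e (Suc s)) \<in> U" by (rule B[OF es])
    show "tridiag d \<alpha> \<beta> \<gamma> (?e (Suc s)) s \<noteq> 0" using s \<gamma>[OF s] by (auto simp: tridiag_def)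
  qed (use s in simp)
  from False U obtain z where z: "z \<in> U" "z \<noteq> (\<lambda>_. 0)" by (auto simp: Vsubspace_def)
  then obtain s where zs: "z s \<noteq> 0" by auto
  then have s: "s \<le> d" using z U unfolding Vsubspace_def Vspace_def by (metis (mono_tags) mem_Collect_eq not_le subsetD)
  have es: "?e s \<in> U" by (rule sep[OF z(1) zs s])
  have e0: "?e 0 \<in> U" using es s
  proof (induction s)
    case (Suc s) then show ?case using down[of s] by simp
  qed
  have "?e t \<in> U" if "t \<le> d" for t using that
  proof (induction t)
    case 0 show ?case by (rule e0)
  next
    case (Suc t) then show ?case using up[of t] by simp
  qed
  then have "U = Vspace d" by (rule Vsubspace_eq_Vspace[OF U])
  then show ?thesis ..
qed simp

section \<open>Laurent polynomial identities\<close>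

text \<open>The q-integer without its denominator. The factor \<open>(q - inverse q) ^ 2\<close> in
  the images of the generators clears the denominators that occur.\<close>

definition qbr :: "complex \<Rightarrow> int \<Rightarrow> complex" where
  "qbr q x = q powi x - q powi (- x)"

lemma qbr_0 [simp]: "qbr q 0 = 0"
  by (simp add: qbr_def)

lemma powi_double: "q \<noteq> 0 \<Longrightarrow> q powi (2 * x) = q powi x * q powi x" for q :: complex
  by (metis mult_2 power_int_add)

lemma powi_eq_1_imp_0:
  fixes q :: complex
  assumes "q \<noteq> 0" "\<forall>k::nat. 0 < k \<longrightarrow> q ^ k \<noteq> 1" "q powi x = 1"
  shows "x = 0"
proof (rule ccontr)
  assume "x \<noteq> 0"
  then have "q ^ nat \<bar>x\<bar> = 1"
    using assms(3) by (cases "x \<ge> 0") (auto simp: power_int_def power_inverse)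
  then show False using assms(2) \<open>x \<noteq> 0\<close> by (metis nat_0_iff not_gr_zero abs_le_zero_iff)
qed

lemma powi_inject:
  fixes q :: complex
  assumes "q \<noteq> 0" "\<forall>k::nat. 0 < k \<longrightarrow> q ^ k \<noteq> 1" "q powi x = q powi y"
  shows "x = y"
proof -
  have "q powi (x - y) = 1" using assms by (simp add: power_int_diff)
  then show ?thesis using powi_eq_1_imp_0[OF assms(1,2)] by fastforce
qed

lemma qbr_nonzero:
  assumes "q \<noteq> 0" "\<forall>k::nat. 0 < k \<longrightarrow> q ^ k \<noteq> 1" "x \<noteq> 0"
  shows "qbr q x \<noteq> 0"
  using powi_inject[OF assms(1,2), of x "- x"] assms(3) by (auto simp: qbr_def)

text \<open>The coefficient of \<open>u_s\<close> in the relation for \<open>B\<close> on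
  \<open>m_k\<close>, divided by \<open>\<delta> * P k s\<close> and multiplied by
  \<open>qbr q (k + 1 - s)\<close>. The summands on the left come from \<open>P k (s - 1)\<close>,
  \<open>P k s\<close> and \<open>P k (s + 1)\<close>, the right side from
  \<open>P (k + 1) s\<close>.\<close>

lemma three_term_identity:
  fixes q :: complex and s k J M r p :: int
  assumes q: "q \<noteq> 0" and rp: "r = 0 \<or> p = 0"
  shows "- (q powi (r + p + s)) * q powi (s - k) * qbr q s * qbr q (J + 1 - s) * qbr q (M + 1 - s)
   + (q powi (p - J + 2 * s) * qbr q (r + s + 1) * qbr q (M - s)
      + q powi (r - M + 2 * s) * qbr q (J - s + 1) * qbr q (p + s)
      + q powi (M + p - J - r - 1) + q powi (J + r + 1 - M - p)
      - q powi (M + J + r + p + 1 - 2 * k) - q powi (2 * k - M - J - r - p - 1)) * qbr q (k + 1 - s)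
   - q powi (2 * s + k - M - J) * qbr q (r + p + s + 1) * qbr q (k - s) * qbr q (k + 1 - s)
   = - (q powi (r + p + 1 + s)) * qbr q (k + 1) * qbr q (J - k) * qbr q (M - k)"
proof -
  \<comment> \<open>Naming the six powers leaves a rational identity in these letters and
    \<open>q\<close>; the hypothesis on \<open>r\<close> and \<open>p\<close> becomes
    \<open>R = 1\<close> or \<open>Z = 1\<close>.\<close>
  define S K X Y R Z where "S = q powi s" "K = q powi k" "X = q powi J" "Y = q powi M"
    "R = q powi r" "Z = q powi p"
  note defs = this
  have nz: "S \<noteq> 0" "K \<noteq> 0" "X \<noteq> 0" "Y \<noteq> 0" "R \<noteq> 0" "Z \<noteq> 0" using q by (auto simp: defs)
  from rp have "R = 1 \<or> Z = 1" by (auto simp: defs)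
  then show ?thesis
    using q nz unfolding qbr_def
    apply (simp add: power_int_add power_int_diff power_int_minus powi_double flip: defs)
    apply (elim disjE)
    apply (simp_all add: field_simps)
    done
qed

text \<open>The coefficient of \<open>u_s\<close> in the relation for \<open>C\<close> on
  \<open>m_k\<close>, divided by \<open>lam * P k s\<close>. The bracketed difference on the right
  is \<open>\<theta> s - \<theta> k\<close> up to the factor \<open>\<delta> * lam\<close>.\<close>

lemma two_term_identity:
  fixes q :: complex and s k J M r p :: int
  assumes q: "q \<noteq> 0"
  shows "q powi (r - M + 2 * s) - q powi (r - M + 2 * k)
      + q powi (k - p - M - 1) * qbr q (r + p + s + 1) * qbr q (k - s)
    = - (q powi (2 * k - M - p - J - r - 2)) * (q powi (J - p - 2 * s) - q powi (J - p - 2 * k))"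
proof -
  define S K X Y R Z where "S = q powi s" "K = q powi k" "X = q powi J" "Y = q powi M"
    "R = q powi r" "Z = q powi p"
  note defs = this
  have nz: "S \<noteq> 0" "K \<noteq> 0" "X \<noteq> 0" "Y \<noteq> 0" "R \<noteq> 0" "Z \<noteq> 0" using q by (auto simp: defs)
  show ?thesis
    using q nz unfolding qbr_def
    apply (simp add: power_int_add power_int_diff power_int_minus powi_double power2_eq_square flip: defs)
    apply (simp add: field_simps)
    done
qed

lemma powi_diff_factor:
  fixes q :: complex
  assumes "q \<noteq> 0"
  shows "q powi (x - 2 * s) - q powi (x - 2 * k) = q powi (x - s - k) * qbr q (k - s)"
proof -
  have "x - 2 * s = (x - s - k) + (k - s)" "x - 2 * k = (x - s - k) + (- (k - s))" by auto
  then show ?thesis unfolding qbr_def right_diff_distrib by (simp only: power_int_add[OF disjI1[OF assms]])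
qed

section \<open>The action on tensors\<close>

lemma HAop_apply:
  assumes "\<delta> = 1 \<or> \<delta> = -1"
  shows "HAop q m n \<delta> lam x (i, j)
    = (if i \<le> m \<and> j \<le> n then \<delta> * lam * q powi (- (int n - 2 * int j)) * x (i, j) else 0)"
  using assms by (auto simp: HAop_def K2invop_def)

lemma HCop_apply:
  assumes "q \<noteq> 0" "\<forall>k::nat. 0 < k \<longrightarrow> q ^ k \<noteq> 1" "\<delta> = 1 \<or> \<delta> = -1" "lam \<noteq> 0"
  shows "HCop q m n \<delta> lam x (i, j)
    = (if i \<le> m \<and> j \<le> n then lam * q powi (- (int m - 2 * int i)) * x (i, j)
       - (if i < m \<and> 0 < j then q * \<delta> * lam ^ 2 * q powi (- (int n - 2 * int (j - 1)))
            * qbr q (int i + 1) * qbr q (int m - int i) * x (i + 1, j - 1) else 0) else 0)"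
proof -
  define h where "h = q - inverse q"
  have h: "h \<noteq> 0" using qbr_nonzero[OF assms(1,2), of 1] by (simp add: h_def qbr_def power_int_minus)
  have qi: "qint q y = qbr q y / h" for y by (simp add: qint_def qbr_def h_def)
  have dinv: "inverse \<delta> = \<delta>" using assms(3) by auto
  have ll: "lam * (lam * (inverse lam * y)) = lam * y" for y using assms(4) by simp
  show ?thesis using h assms(4)
    by (simp add: HCop_def Iop_def K1invop_def E1op_def F2op_def K2invop_def qi dinv
        flip: h_def) (auto simp: power2_eq_square ll ac_simps)
qed

text \<open>Expanding the product of \<open>E1 + K1^(-1) E2\<close> and \<open>F1 K2 + F2\<close>
  gives four terms: \<open>E1 F1 K2\<close> and \<open>K1^(-1) E2 F2\<close> are diagonal, while
  \<open>E1 F2\<close> and \<open>K1^(-1) E2 F1 K2\<close> reach the two neighbours with the same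
  \<open>i + j\<close>.\<close>

lemma HBop_apply:
  assumes "q \<noteq> 0" "\<forall>k::nat. 0 < k \<longrightarrow> q ^ k \<noteq> 1" "\<delta> = 1 \<or> \<delta> = -1" "lam \<noteq> 0"
  shows "HBop q m n \<delta> lam x (i, j)
    = (if i \<le> m \<and> j \<le> n then
        \<delta> * (q powi (int n - 2 * int j) * qbr q (int i + 1) * qbr q (int m - int i)
           + q powi (- (int m - 2 * int i)) * qbr q (int j + 1) * qbr q (int n - int j)
           + inverse q * q powi (int m - 2 * int i) * q powi (int n - 2 * int j)
           + q * q powi (- (int m - 2 * int i)) * q powi (- (int n - 2 * int j))) * x (i, j)
       + (if i < m \<and> 0 < j then lam * qbr q (int i + 1) * qbr q (int m - int i) * x (i + 1, j - 1) else 0)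
       + (if 0 < i \<and> j < n then inverse lam * q powi (- (int m - 2 * int i)) * q powi (int n - 2 * int (j + 1))
            * qbr q (int j + 1) * qbr q (int n - int j) * x (i - 1, j + 1) else 0) else 0)"
proof -
  define h where "h = q - inverse q"
  have h: "h \<noteq> 0" using qbr_nonzero[OF assms(1,2), of 1] by (simp add: h_def qbr_def power_int_minus)
  have qi: "qint q y = qbr q y / h" for y by (simp add: qint_def qbr_def h_def)
  have dl: "inverse lam * (inverse \<delta> * lam) = \<delta>" using assms(3,4) by auto
  have dd: "\<delta> * (lam * (\<delta> * inverse lam)) = 1" using assms(3,4) by auto
  show ?thesis
  proof (cases "i \<le> m \<and> j \<le> n")
    case True
    let ?x = "x (i, j)"
    \<comment> \<open>At \<open>i = m\<close> the left side is cut off by the guard in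
      \<open>E1op\<close>; the right side agrees because \<open>qbr q (int m - int i)\<close>
      vanishes there. The fourth term behaves likewise at \<open>j = n\<close>.\<close>
    have 1: "h\<^sup>2 * E1op q m n \<delta> lam (F1op q m n \<delta> lam (K2op q m n \<delta> lam x)) (i, j)
        = \<delta> * q powi (int n - 2 * int j) * qbr q (int i + 1) * qbr q (int m - int i) * ?x"
      using True h assms(4) by (cases "i = m") (auto simp: E1op_def F1op_def K2op_def qi power2_eq_square)
    have 2: "h\<^sup>2 * E1op q m n \<delta> lam (F2op q m n \<delta> lam x) (i, j)
        = (if i < m \<and> 0 < j then lam * qbr q (int i + 1) * qbr q (int m - int i) * x (i + 1, j - 1) else 0)"
      using True h by (auto simp: E1op_def F2op_def qi power2_eq_square)
    have 3: "h\<^sup>2 * K1invop q m n \<delta> lam (E2op q m n \<delta> lam (F1op q m n \<delta> lam (K2op q m n \<delta> lam x))) (i, j)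
        = (if 0 < i \<and> j < n then inverse lam * q powi (- (int m - 2 * int i)) * q powi (int n - 2 * int (j + 1))
            * qbr q (int j + 1) * qbr q (int n - int j) * x (i - 1, j + 1) else 0)"
      using True h assms(4) by (auto simp: K1invop_def E2op_def F1op_def K2op_def qi dd power2_eq_square)
    have 4: "h\<^sup>2 * K1invop q m n \<delta> lam (E2op q m n \<delta> lam (F2op q m n \<delta> lam x)) (i, j)
        = \<delta> * q powi (- (int m - 2 * int i)) * qbr q (int j + 1) * qbr q (int n - int j) * ?x"
      using True h assms(4) by (cases "j = n") (auto simp: K1invop_def E2op_def F2op_def qi power2_eq_square)
    have 5: "K1op q m n \<delta> lam (K2op q m n \<delta> lam x) (i, j)
        = \<delta> * q powi (int m - 2 * int i) * q powi (int n - 2 * int j) * ?x"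
      using True assms(4) by (simp add: K1op_def K2op_def)
    have 6: "K1invop q m n \<delta> lam (K2invop q m n \<delta> lam x) (i, j)
        = \<delta> * q powi (- (int m - 2 * int i)) * q powi (- (int n - 2 * int j)) * ?x"
      using True assms(4) by (simp add: K1invop_def K2invop_def dl)
    show ?thesis
      unfolding HBop_def h_def[symmetric] distrib_left 1 2 3 4 5 6 using True
      by (simp add: algebra_simps)
  next
    case False
    then show ?thesis by (auto simp: HBop_def E1op_def K1invop_def K1op_def)
  qed
qed

text \<open>\<open>K1 K2\<close> is diagonal, \<open>lam\<close> cancels, and the eigenvalue depends
  on \<open>i + j\<close> only; since \<open>q\<close> is not a root of unity, different values of
  \<open>i + j\<close> give different eigenvalues.\<close>

lemma K1K2_eigenspace_eq:
  assumes "q \<noteq> 0" "\<forall>k::nat. 0 < k \<longrightarrow> q ^ k \<noteq> 1" "\<delta> = 1 \<or> \<delta> = -1" "lam \<noteq> 0"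
  shows "K1K2_eigenspace q m n \<delta> lam (\<delta> * q powi (int m + int n - 2 * int l))
    = {x. \<forall>i j. x (i, j) \<noteq> 0 \<longrightarrow> i \<le> m \<and> j \<le> n \<and> i + j = l}" (is "?L = ?R")
proof -
  have KK: "K1op q m n \<delta> lam (K2op q m n \<delta> lam x) (i, j)
      = (if i \<le> m \<and> j \<le> n then \<delta> * q powi (int m + int n - 2 * int (i + j)) * x (i, j) else 0)" for x i j
  proof -
    have "int m + int n - 2 * int (i + j) = (int m - 2 * int i) + (int n - 2 * int j)" by simp
    then have "q powi (int m + int n - 2 * int (i + j)) = q powi (int m - 2 * int i) * q powi (int n - 2 * int j)"
      by (simp only: power_int_add[OF disjI1[OF assms(1)]])
    then show ?thesis using assms(4) by (simp add: K1op_def K2op_def)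
  qed
  show ?thesis
  proof (intro set_eqI iffI)
    fix x assume x: "x \<in> ?L"
    have "i \<le> m \<and> j \<le> n \<and> i + j = l" if nz: "x (i, j) \<noteq> 0" for i j
    proof -
      have ij: "i \<le> m" "j \<le> n" using x nz by (auto simp: K1K2_eigenspace_def tens_space_def not_le[symmetric])
      have "K1op q m n \<delta> lam (K2op q m n \<delta> lam x) (i, j) = \<delta> * q powi (int m + int n - 2 * int l) * x (i, j)"
        using x by (simp add: K1K2_eigenspace_def)
      then have "q powi (int m + int n - 2 * int (i + j)) = q powi (int m + int n - 2 * int l)"
        using nz assms(3) ij unfolding KK by auto
      then have "int m + int n - 2 * int (i + j) = int m + int n - 2 * int l"
        by (rule powi_inject[OF assms(1,2)])
      then show ?thesis using ij by auto
    qed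
    then show "x \<in> ?R" by blast
  next
    fix x assume "x \<in> ?R"
    then have x: "\<And>i j. x (i, j) \<noteq> 0 \<Longrightarrow> i \<le> m \<and> j \<le> n \<and> i + j = l" by blast
    have "K1op q m n \<delta> lam (K2op q m n \<delta> lam x) (i, j) = \<delta> * q powi (int m + int n - 2 * int l) * x (i, j)" for i j
      using x[of i j] unfolding KK by (cases "x (i, j) = 0") auto
    moreover have "x \<in> tens_space m n" unfolding tens_space_def using x by force
    ultimately show "x \<in> ?L" by (auto simp: K1K2_eigenspace_def)
  qed
qed

text \<open>An entry of the image at \<open>(i, j)\<close> involves only entries of \<open>x\<close>
  with the same index sum.\<close>

lemma weight_space_submodule:
  assumes h: "q \<noteq> 0" "\<forall>k::nat. 0 < k \<longrightarrow> q ^ k \<noteq> 1" "\<delta> = 1 \<or> \<delta> = -1" "lam \<noteq> 0"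
    and W: "W = {x. \<forall>i j. x (i, j) \<noteq> 0 \<longrightarrow> i \<le> m \<and> j \<le> n \<and> i + j = l}" and x: "x \<in> W"
  shows "HAop q m n \<delta> lam x \<in> W \<and> HBop q m n \<delta> lam x \<in> W \<and> HCop q m n \<delta> lam x \<in> W"
proof -
  have z: "x (i, j) = 0" if "i + j \<noteq> l" for i j using x that unfolding W by auto
  have "HAop q m n \<delta> lam x (i, j) = 0 \<and> HBop q m n \<delta> lam x (i, j) = 0 \<and> HCop q m n \<delta> lam x (i, j) = 0"
    if "\<not> (i \<le> m \<and> j \<le> n \<and> i + j = l)" for i j
  proof (cases "i \<le> m \<and> j \<le> n")
    case True
    with that have "i + j \<noteq> l" by auto
    then have "x (i, j) = 0" "0 < j \<Longrightarrow> x (i + 1, j - 1) = 0" "0 < i \<Longrightarrow> x (i - 1, j + 1) = 0"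
      by (auto intro!: z)
    then show ?thesis
      unfolding HAop_apply[OF h(3)] HBop_apply[OF h] HCop_apply[OF h] by simp
  next
    case False then show ?thesis
      unfolding HAop_apply[OF h(3)] HBop_apply[OF h] HCop_apply[OF h] by auto
  qed
  then show ?thesis unfolding W mem_Collect_eq by blast
qed

section \<open>A single weight space\<close>

text \<open>The dictionary is \<open>m = M + r\<close>, \<open>n = J + p\<close>,
  \<open>l = J + r\<close>. With these parameters all formulas avoid truncated subtraction and
  minima, except through \<open>d\<close>.\<close>

locale hahn_tensor =
  fixes q \<delta> lam :: complex and J M r p :: nat
  assumes q0: "q \<noteq> 0" and qroot: "\<forall>k::nat. 0 < k \<longrightarrow> q ^ k \<noteq> 1"
    and delta: "\<delta> = 1 \<or> \<delta> = -1" and lam0: "lam \<noteq> 0"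
    and rp: "r = 0 \<or> p = 0"
begin

abbreviation "br \<equiv> qbr q"

lemmas br_nz = qbr_nonzero[OF q0 qroot]
lemmas powi_add = power_int_add[OF disjI1[OF q0]]

lemma delta_nz [simp]: "\<delta> \<noteq> 0" and delta_sq [simp]: "\<delta> * \<delta> = 1" "\<delta> * (\<delta> * x) = x"
  and delta_inv [simp]: "inverse \<delta> = \<delta>"
  using delta by auto

section \<open>Matrix entries in the weight basis and parameters of the target module\<close>

definition d :: nat where "d = min J M"

text \<open>\<open>\<theta>\<close> and \<open>\<epsilon>\<close> are the diagonal entries of
  \<open>A\<close> and \<open>C\<close> on \<open>u_s\<close>; \<open>\<theta>\<close> is also the
  sequence of eigenvalues of \<open>A\<close> on the module \<open>V_d\<close>.\<close>

definition \<theta> :: "nat \<Rightarrow> complex" where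
  "\<theta> s = \<delta> * lam * q powi (int J - int p - 2 * int s)"

definition \<epsilon> :: "nat \<Rightarrow> complex" where
  "\<epsilon> s = lam * q powi (int r - int M + 2 * int s)"

text \<open>The next four sequences are matrix entries at \<open>u_s\<close>:
  \<open>\<alpha>\<close>, \<open>\<beta>\<close>, \<open>\<gamma>\<close> for \<open>B\<close> (to
  \<open>u_s\<close>, \<open>u_(s+1)\<close>, \<open>u_(s-1)\<close>), and \<open>\<eta>\<close> for
  \<open>C\<close> (to \<open>u_(s-1)\<close>).\<close>

definition \<alpha> :: "nat \<Rightarrow> complex" where
  "\<alpha> s = \<delta> * (q powi (int p - int J + 2 * int s) * br (int r + int s + 1) * br (int M - int s)
      + q powi (int r - int M + 2 * int s) * br (int J - int s + 1) * br (int p + int s)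
      + q powi (int M + int p - int J - int r - 1) + q powi (int J + int r + 1 - int M - int p))"

definition \<beta> :: "nat \<Rightarrow> complex" where
  "\<beta> s = inverse lam * q powi (int p - int J - int M + int r + 4 * int s + 2)
      * br (int J - int s) * br (int p + int s + 1)"

definition \<gamma> :: "nat \<Rightarrow> complex" where
  "\<gamma> s = lam * br (int r + int s) * br (int M + 1 - int s)"

definition \<eta> :: "nat \<Rightarrow> complex" where
  "\<eta> s = - (\<delta> * lam * q powi (int J - int p - 2 * int s + 1)) * \<gamma> s"

text \<open>\<open>\<theta>s\<close>, \<open>\<phi>\<close> and \<open>\<phi>\<epsilon>\<close> are
  the parameters of \<open>V_d(a,b,c)\<close> written without \<open>d\<close>; the equality is
  proved in \<open>hths_eq\<close>, \<open>hphi_eq\<close> and \<open>hphie_eq\<close>.\<close>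

definition \<theta>s :: "nat \<Rightarrow> complex" where
  "\<theta>s k = \<delta> * (q powi (int M + int J + int r + int p + 1 - 2 * int k)
      + q powi (2 * int k - int M - int J - int r - int p - 1))"

definition \<phi> :: "nat \<Rightarrow> complex" where
  "\<phi> k = - (lam * q powi (int J + int r + 1 - int k)) * br (int k) * br (int J + 1 - int k) * br (int M + 1 - int k)"

definition \<phi>\<epsilon> :: "nat \<Rightarrow> complex" where
  "\<phi>\<epsilon> k = \<delta> * lam * q powi (int k - int M - int p - 1) * br (int k) * br (int J + 1 - int k) * br (int M + 1 - int k)"

text \<open>The part depending on \<open>s\<close> alone in the ratio
  \<open>\<phi> (k + 1) / (\<theta> s - \<theta> (k + 1))\<close>, once that ratio is written with
  q-brackets.\<close>

definition \<kappa> :: "nat \<Rightarrow> complex" where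
  "\<kappa> s = - (\<delta> * q powi (int r + int p + 1 + int s))"

definition a :: complex where "a = \<delta> * lam * q powi (int J - int p - int d)"
definition b :: complex where "b = \<delta> * q powi (int M + int J + int r + int p + 1 - int d)"
definition c :: complex where "c = lam * q powi (int r - int M + int d)"

lemma q_pow_powi: "q ^ k = q powi int k" by simp

lemma hth_eq: "hth q a d s = \<theta> s"
  unfolding hth_def a_def \<theta>_def q_pow_powi mult.assoc powi_add[symmetric]
  by (simp add: algebra_simps)

lemma hthe_eq: "hthe q c d s = \<epsilon> s"
  unfolding hthe_def c_def \<epsilon>_def q_pow_powi mult.assoc powi_add[symmetric] power_int_minus[symmetric]
  by (simp add: algebra_simps)

lemma hths_eq: "hths q b d s = \<theta>s s"
  unfolding hths_def b_def \<theta>s_def q_pow_powi inverse_mult_distrib delta_inv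
    mult.assoc powi_add[symmetric] power_int_minus[symmetric]
  by (simp add: algebra_simps)

text \<open>Since \<open>d = min J M\<close>, the numbers \<open>d\<close> and
  \<open>M + J - d\<close> are \<open>J\<close> and \<open>M\<close> in some order. This is how
  \<open>d\<close> disappears from \<open>\<phi>\<close> and
  \<open>\<phi>\<epsilon>\<close>.\<close>

lemma br_d_swap:
  "br (int d + 1 - x) * br (int M + int J + 1 - int d - x) = br (int J + 1 - x) * br (int M + 1 - x)"
  by (cases "J \<le> M") (auto simp: d_def algebra_simps)

lemma hphi_eq: "hphi q a b c d k = \<phi> k"
proof -
  let ?e = "int M + int J + 1 - int d"
  \<comment> \<open>The exponents of \<open>q\<close> in \<open>c\<close> and in the product
    subtracted from it lie symmetrically about \<open>?u\<close>, at distance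
    \<open>?e - int k\<close>, so their difference is a single bracket.\<close>
  let ?u = "int J + int r + 1 - int k"
  have "q powi (?u + (?e - int k)) = q powi (int J - int p - int d)
      * q powi (int M + int J + int r + int p + 1 - int d) * q powi int d * q powi (1 - 2 * int k)"
    unfolding powi_add[symmetric] by (simp add: algebra_simps)
  then have "a * b * q ^ d * q powi (1 - 2 * int k) = lam * q powi (?u + (?e - int k))"
    unfolding a_def b_def q_pow_powi by (simp only: ac_simps delta_sq)
  moreover have "c = lam * q powi (?u + (- (?e - int k)))"
    unfolding c_def by (simp add: algebra_simps)
  ultimately have 1: "c - a * b * q ^ d * q powi (1 - 2 * int k) = - (lam * q powi ?u) * br (?e - int k)"
    unfolding qbr_def powi_add by (simp add: right_diff_distrib ac_simps)
  have 2: "q ^ d * q powi (1 - int k) - inverse (q ^ d) * q powi (int k - 1) = br (int d + 1 - int k)"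
    unfolding qbr_def q_pow_powi power_int_minus[symmetric] powi_add[symmetric]
    by (simp add: algebra_simps)
  have "hphi q a b c d k = - (lam * q powi (int J + int r + 1 - int k)) * br (int k)
      * (br (int d + 1 - int k) * br (?e - int k))"
    unfolding hphi_def 1 2 qbr_def[of q "int k"] by (simp add: ac_simps)
  then show ?thesis unfolding br_d_swap \<phi>_def by (simp add: ac_simps)
qed

lemma hphie_eq: "hphie q a b c d k = \<phi>\<epsilon> k"
proof -
  let ?e = "int M + int J + 1 - int d"
  \<comment> \<open>Again the midpoint of the two exponents, now of those in \<open>a\<close> and in
    the product subtracted from it.\<close>
  let ?u = "int k - int M - int p - 1"
  have "q powi (?u + (- (?e - int k))) = q powi (- (int M + int J + int r + int p + 1 - int d))
      * q powi (int r - int M + int d) * q powi (- int d) * q powi (2 * int k - 1)"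
    unfolding powi_add[symmetric] by (simp add: algebra_simps)
  then have "inverse b * c * inverse (q ^ d) * q powi (2 * int k - 1) = \<delta> * lam * q powi (?u + (- (?e - int k)))"
    unfolding c_def b_def q_pow_powi inverse_mult_distrib delta_inv power_int_minus[symmetric] by (simp only: ac_simps)
  moreover have "a = \<delta> * lam * q powi (?u + (?e - int k))"
    unfolding a_def by (simp add: algebra_simps)
  ultimately have 1: "a - inverse b * c * inverse (q ^ d) * q powi (2 * int k - 1)
      = \<delta> * lam * q powi ?u * br (?e - int k)"
    unfolding qbr_def powi_add by (simp add: right_diff_distrib ac_simps)
  have 2: "q ^ d * q powi (1 - int k) - inverse (q ^ d) * q powi (int k - 1) = br (int d + 1 - int k)"
    unfolding qbr_def q_pow_powi power_int_minus[symmetric] powi_add[symmetric]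
    by (simp add: algebra_simps)
  have "hphie q a b c d k = \<delta> * lam * q powi (int k - int M - int p - 1) * br (int k)
      * (br (int d + 1 - int k) * br (?e - int k))"
    unfolding hphie_def 1 2 qbr_def[of q "int k"] by (simp add: ac_simps)
  then show ?thesis unfolding br_d_swap \<phi>\<epsilon>_def by (simp add: ac_simps)
qed

lemma \<theta>_diff: "\<theta> s - \<theta> k = \<delta> * lam * q powi (int J - int p - int s - int k) * br (int k - int s)"
  unfolding \<theta>_def right_diff_distrib[symmetric] powi_diff_factor[OF q0] by simp

lemma \<theta>_diff_nz: "s \<noteq> k \<Longrightarrow> \<theta> s - \<theta> k \<noteq> 0"
  unfolding \<theta>_diff using br_nz[of "int k - int s"] q0 lam0 by auto

lemma \<beta>_nz: "s < d \<Longrightarrow> \<beta> s \<noteq> 0"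
  unfolding \<beta>_def d_def using br_nz[of "int J - int s"] br_nz[of "int p + int s + 1"] q0 lam0 by auto

lemma \<gamma>_nz: "s < d \<Longrightarrow> \<gamma> (s + 1) \<noteq> 0"
  unfolding \<gamma>_def d_def using br_nz[of "int r + int (s + 1)"] br_nz[of "int M + 1 - int (s + 1)"] lam0 by auto

lemma \<kappa>_nz: "\<kappa> s \<noteq> 0"
  unfolding \<kappa>_def using q0 by simp

lemma \<kappa>_Suc: "\<kappa> (Suc s) = q * \<kappa> s"
proof -
  have "q powi (int r + int p + 1 + int (Suc s)) = q powi (1 + (int r + int p + 1 + int s))"
    by (simp add: algebra_simps)
  then show ?thesis unfolding \<kappa>_def powi_add by simp
qed

section \<open>The transition matrix and the ratios of its neighbouring entries\<close>

definition P :: "nat \<Rightarrow> nat \<Rightarrow> complex" where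
  "P k s = (if s \<le> k then (\<Prod>t<s. \<beta> t) * (\<Prod>t\<in>{s<..k}. \<phi> t / (\<theta> s - \<theta> t)) else 0)"

lemma P_upper: "k < s \<Longrightarrow> P k s = 0" by (simp add: P_def)

lemma P_diag: "P k k = (\<Prod>t<k. \<beta> t)" by (simp add: P_def)

lemma P_diag_nz: "k \<le> d \<Longrightarrow> P k k \<noteq> 0"
  using \<beta>_nz by (auto simp: P_diag)

text \<open>The relation for \<open>A\<close> at \<open>u_s\<close>. At \<open>s = Suc k\<close>
  both sides vanish, which is why the diagonal entries of \<open>P\<close> may be chosen freely and
  are left to the relation for \<open>B\<close>.\<close>

lemma P_Suc: "P (Suc k) s * (\<theta> s - \<theta> (Suc k)) = \<phi> (Suc k) * P k s"
proof (cases "s \<le> k")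
  case True
  then have "{s<..Suc k} = insert (Suc k) {s<..k}" by auto
  then show ?thesis using True \<theta>_diff_nz[of s "Suc k"] by (simp add: P_def)
next
  case False
  then show ?thesis by (cases "s = Suc k") (auto simp: P_upper)
qed

lemma P_Suc_br:
  "P (Suc k) s * br (int k + 1 - int s)
    = \<kappa> s * br (int k + 1) * br (int J - int k) * br (int M - int k) * P k s"
proof -
  let ?u = "\<delta> * lam * q powi (int J - int p - int s - int (Suc k))"
  have "q powi (int J + int r + 1 - int (Suc k))
     = q powi ((int r + int p + 1 + int s) + (int J - int p - int s - int (Suc k)))"
    by (simp add: algebra_simps)
  then have u: "- (lam * q powi (int J + int r + 1 - int (Suc k))) = ?u * \<kappa> s"
    unfolding powi_add \<kappa>_def by (simp add: ac_simps)
  have "?u * (P (Suc k) s * br (int k + 1 - int s)) = P (Suc k) s * (\<theta> s - \<theta> (Suc k))"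
    unfolding \<theta>_diff by (simp add: ac_simps)
  also have "\<dots> = \<phi> (Suc k) * P k s" by (rule P_Suc)
  also have "\<dots> = ?u * (\<kappa> s * br (int k + 1) * br (int J - int k) * br (int M - int k) * P k s)"
    unfolding \<phi>_def u by (simp add: ac_simps)
  finally show ?thesis using q0 lam0 by simp
qed

text \<open>Compares neighbouring columns by moving down the rows with \<open>P_Suc_br\<close>; the
  start is \<open>P (s + 1) (s + 1) = \<beta> s * P s s\<close>. It is stated without division
  because \<open>br (int J - int s)\<close> and \<open>br (int M - int s)\<close> can
  vanish.\<close>

lemma P_col:
  assumes "s \<le> k"
  shows "P k (Suc s) * (br (int s + 1) * br (int J - int s) * br (int M - int s) * \<kappa> s)
    = \<beta> s * q powi (int k - int s - 1) * br (int k - int s) * P k s"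
  using assms
proof (induction k rule: dec_induct)
  case base show ?case by (simp add: P_upper)
next
  case (step k)
  let ?X = "br (int s + 1) * br (int J - int s) * br (int M - int s) * \<kappa> s"
  show ?case
  \<comment> \<open>For \<open>k = s\<close> the bracket \<open>br (int k - int s)\<close> is zero
    and cannot be cancelled, so the first entry below the diagonal zero is checked from the diagonal
    products.\<close>
  proof (cases "k = s")
    case True
    have "P (Suc s) (Suc s) = \<beta> s * P s s" by (simp add: P_diag)
    then show ?thesis using True P_Suc_br[of s s] by (simp add: ac_simps)
  next
    case False
    let ?N = "br (int k + 1) * br (int J - int k) * br (int M - int k)"
    let ?D = "br (int k - int s)"
    have D: "?D \<noteq> 0" using False by (intro br_nz) auto
    have "P (Suc k) (Suc s) * ?D = \<kappa> (Suc s) * ?N * P k (Suc s)"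
      using P_Suc_br[of k "Suc s"] by (simp add: ac_simps)
    moreover have "?D * (P (Suc k) (Suc s) * ?X) = P (Suc k) (Suc s) * ?D * ?X"
      by (simp only: ac_simps)
    ultimately have "?D * (P (Suc k) (Suc s) * ?X) = q * \<kappa> s * ?N * (P k (Suc s) * ?X)"
      unfolding \<kappa>_Suc by (simp only: ac_simps)
    also have "\<dots> = q * \<kappa> s * ?N * (\<beta> s * q powi (int k - int s - 1) * ?D * P k s)"
      using step.IH by simp
    also have "\<dots> = ?D * (\<beta> s * (q * q powi (int k - int s - 1)) * (\<kappa> s * ?N * P k s))"
      by (simp add: ac_simps)
    also have "\<kappa> s * ?N * P k s = P (Suc k) s * br (int k + 1 - int s)"
      using P_Suc_br[of k s] by (simp add: ac_simps)
    also have "q * q powi (int k - int s - 1) = q powi (int (Suc k) - int s - 1)"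
      using powi_add[of 1 "int k - int s - 1"] by (simp add: algebra_simps)
    finally show ?thesis using D by (simp add: ac_simps)
  qed
qed

text \<open>\<open>\<gamma> (Suc s)\<close> supplies the factor \<open>br (int M - int s)\<close>
  required by \<open>P_col\<close>; the remaining factor \<open>?Q\<close> is nonzero for
  \<open>s < k \<le> d\<close> and is cancelled.\<close>

lemma \<gamma>_P:
  assumes "s \<le> k" "k \<le> d"
  shows "\<gamma> (Suc s) * P k (Suc s)
    = - (\<delta> * q powi (2 * int s + int k - int M - int J)) * br (int r + int p + int s + 1) * br (int k - int s) * P k s"
proof (cases "s = k")
  case True then show ?thesis by (simp add: P_upper)
next
  case False
  then have sJ: "s < J" using assms by (auto simp: d_def)
  let ?Q = "br (int s + 1) * br (int J - int s) * \<kappa> s"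
  have Q: "?Q \<noteq> 0" using sJ br_nz[of "int s + 1"] br_nz[of "int J - int s"] \<kappa>_nz by auto
  \<comment> \<open>The pairs \<open>{r, p}\<close> and \<open>{0, r + p}\<close> coincide because
    one of \<open>r\<close>, \<open>p\<close> is zero.\<close>
  have swap: "br (int r + int s + 1) * br (int p + int s + 1) = br (int s + 1) * br (int r + int p + int s + 1)"
    using rp by auto
  have pw: "q powi (int p - int J - int M + int r + 4 * int s + 2) * q powi (int k - int s - 1)
     = q powi (int r + int p + 1 + int s) * q powi (2 * int s + int k - int M - int J)"
    unfolding powi_add[symmetric] by (simp add: algebra_simps)
  have "?Q * (\<gamma> (Suc s) * P k (Suc s)) = lam * br (int r + int s + 1)
     * (P k (Suc s) * (br (int s + 1) * br (int J - int s) * br (int M - int s) * \<kappa> s))"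
    by (simp add: \<gamma>_def ac_simps)
  also have "\<dots> = lam * br (int r + int s + 1) * (\<beta> s * q powi (int k - int s - 1) * br (int k - int s) * P k s)"
    unfolding P_col[OF assms(1)] ..
  also have "\<dots> = (lam * inverse lam) * (br (int r + int s + 1) * br (int p + int s + 1))
     * (q powi (int p - int J - int M + int r + 4 * int s + 2) * q powi (int k - int s - 1))
     * br (int J - int s) * br (int k - int s) * P k s"
    unfolding \<beta>_def by (simp only: ac_simps)
  also have "\<dots> = ?Q * (- (\<delta> * q powi (2 * int s + int k - int M - int J)) * br (int r + int p + int s + 1) * br (int k - int s) * P k s)"
    unfolding swap pw \<kappa>_def using lam0 by (simp add: ac_simps)
  finally show ?thesis unfolding mult_left_cancel[OF Q] .
qed

section \<open>The transition matrix intertwines the three operators\<close>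

abbreviation "A' \<equiv> tridiag d \<theta> (\<lambda>_. 0) (\<lambda>_. 0)"
abbreviation "B' \<equiv> tridiag d \<alpha> \<beta> \<gamma>"
abbreviation "C' \<equiv> tridiag d \<epsilon> (\<lambda>_. 0) \<eta>"

lemma row_comb_VAop: "row_comb d P (VAop q a b c d y) = A' (row_comb d P y)"
proof -
  have main: "\<theta> k * P k s + (if 0 < k then \<phi> k * P (k - 1) s else 0) = \<theta> s * P k s" for k s
  proof (cases k)
    case 0 then show ?thesis by (cases s) (auto simp: P_upper)
  next
    case (Suc k') then show ?thesis using P_Suc[of k' s] by (simp add: algebra_simps)
  qed
  show ?thesis
    unfolding VAop_eq_tridiag
  proof (rule row_comb_tridiag, unfold hth_eq hphi_eq)
    fix k s
    show "\<theta> k * P k s + (if k < d then 0 * P (k + 1) s else 0) + (if 0 < k then \<phi> k * P (k - 1) s else 0)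
      = \<theta> s * P k s + (if 0 < s then 0 * P k (s - 1) else 0) + (if s < d then 0 * P k (s + 1) else 0)"
      unfolding main[of k s, symmetric] by simp
  qed
qed

lemma row_comb_VCop: "row_comb d P (VCop q a b c d y) = C' (row_comb d P y)"
proof -
  have main: "\<epsilon> k * P k s + (if 0 < k then \<phi>\<epsilon> k * P (k - 1) s else 0) = \<epsilon> s * P k s + \<eta> (Suc s) * P k (Suc s)"
    if kd: "k \<le> d" for k s
  proof (cases "s < k")
    case False then show ?thesis by (cases "s = k") (auto simp: P_upper)
  next
    case True
    then obtain k' where k': "k = Suc k'" by (cases k) auto
    let ?v = "2 * int k - int M - int p - int J - int r - 2"
    have "q powi (int k - int M - int p - 1) = q powi ?v * q powi (int J + int r + 1 - int k)"
      unfolding powi_add[symmetric] by (simp add: algebra_simps)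
    \<comment> \<open>\<open>\<phi>\<epsilon> k\<close> and \<open>\<phi> k\<close> differ by a
      monomial factor only, so \<open>P_Suc\<close> also evaluates the lowering term of
      \<open>C\<close> as a multiple of \<open>P k s\<close>.\<close>
    then have \<phi>\<epsilon>: "\<phi>\<epsilon> k = - (\<delta> * q powi ?v) * \<phi> k"
      unfolding \<phi>\<epsilon>_def \<phi>_def by (simp add: ac_simps)
    have "\<phi>\<epsilon> k * P (k - 1) s = - (\<delta> * q powi ?v) * (P k s * (\<theta> s - \<theta> k))"
      unfolding \<phi>\<epsilon> using P_Suc[of k' s] k' by simp
    also have "\<theta> s - \<theta> k = \<delta> * (lam * (q powi (int J - int p - 2 * int s) - q powi (int J - int p - 2 * int k)))"
      unfolding \<theta>_def by (simp add: right_diff_distrib)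
    finally have 1: "\<phi>\<epsilon> k * P (k - 1) s = - (q powi ?v) * (q powi (int J - int p - 2 * int s) - q powi (int J - int p - 2 * int k)) * (lam * P k s)"
      by (simp add: ac_simps)
    have "q powi (int k - int p - int M - 1)
        = q powi (int J - int p - 2 * int (Suc s) + 1) * q powi (2 * int s + int k - int M - int J)"
      unfolding powi_add[symmetric] by (simp add: algebra_simps)
    then have 2: "\<eta> (Suc s) * P k (Suc s)
        = q powi (int k - int p - int M - 1) * br (int r + int p + int s + 1) * br (int k - int s) * (lam * P k s)"
      unfolding \<eta>_def mult.assoc using \<gamma>_P[of s k] True kd by (simp add: ac_simps)
    have "\<epsilon> s * P k s - \<epsilon> k * P k s + \<eta> (Suc s) * P k (Suc s) = \<phi>\<epsilon> k * P (k - 1) s"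
      unfolding 1 2 two_term_identity[OF q0, symmetric] \<epsilon>_def by (simp add: algebra_simps)
    then show ?thesis using True by (simp add: algebra_simps)
  qed
  \<comment> \<open>For \<open>s \<ge> d \<ge> k\<close> the entry lies above the diagonal, so the
    cut-off at \<open>d\<close> loses nothing.\<close>
  have \<eta>: "\<eta> (Suc s) * P k (Suc s) = (if s < d then \<eta> (s + 1) * P k (s + 1) else 0)" if "k \<le> d" for k s
    using that by (auto simp: P_upper)
  show ?thesis
    unfolding VCop_eq_tridiag
  proof (rule row_comb_tridiag, unfold hthe_eq hphie_eq)
    fix k s assume k: "k \<le> d"
    show "\<epsilon> k * P k s + (if k < d then 0 * P (k + 1) s else 0) + (if 0 < k then \<phi>\<epsilon> k * P (k - 1) s else 0)
      = \<epsilon> s * P k s + (if 0 < s then 0 * P k (s - 1) else 0) + (if s < d then \<eta> (s + 1) * P k (s + 1) else 0)"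
      unfolding \<eta>[OF k, of s, symmetric] using main[OF k, of s] by (simp only: mult_zero_left if_cancel add_0_right)
  qed
qed

lemma row_comb_VBop: "row_comb d P (VBop q a b c d y) = B' (row_comb d P y)"
proof -
  have main: "\<theta>s k * P k s + P (Suc k) s
     = \<alpha> s * P k s + (if 0 < s then \<beta> (s - 1) * P k (s - 1) else 0) + \<gamma> (Suc s) * P k (Suc s)"
    if kd: "k \<le> d" for k s
  proof (cases "s \<le> k")
    case False
    then show ?thesis by (cases "s = Suc k") (auto simp: P_upper P_diag)
  next
    case sk: True
    \<comment> \<open>Multiplying by this nonzero bracket makes every term of the relation an
      explicit multiple of \<open>\<delta> * P k s\<close>.\<close>
    let ?D = "br (int k + 1 - int s)"
    let ?T = "if 0 < s then \<beta> (s - 1) * P k (s - 1) else 0"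
    have D: "?D \<noteq> 0" using sk by (intro br_nz) auto
    have T: "?T * ?D = (\<delta> * P k s) * (- (q powi (int r + int p + int s)) * q powi (int s - int k) * br (int s)
        * br (int J + 1 - int s) * br (int M + 1 - int s))"
    proof (cases s)
      case 0 then show ?thesis by simp
    next
      case (Suc t)
      \<comment> \<open>This factor 1 is inserted to produce the power of \<open>q\<close> that
        \<open>P_col\<close> expects.\<close>
      have e: "q powi (int s - int k) * q powi (int k - int t - 1) = 1"
        unfolding powi_add[symmetric] using Suc by simp
      have "?T * ?D = (q powi (int s - int k) * q powi (int k - int t - 1)) * (\<beta> t * P k t * br (int k - int t))"
        unfolding e using Suc by simp
      also have "\<dots> = q powi (int s - int k) * (\<beta> t * q powi (int k - int t - 1) * br (int k - int t) * P k t)"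
        by (simp only: ac_simps)
      also have "\<dots> = q powi (int s - int k) * (P k (Suc t) * (br (int t + 1) * br (int J - int t) * br (int M - int t) * \<kappa> t))"
        using P_col[of t k] sk Suc by simp
      finally show ?thesis using Suc by (simp add: \<kappa>_def algebra_simps)
    qed
    have G: "\<gamma> (Suc s) * P k (Suc s)
      = - (\<delta> * P k s) * (q powi (2 * int s + int k - int M - int J) * br (int r + int p + int s + 1) * br (int k - int s))"
      using \<gamma>_P[OF sk kd] by (simp add: ac_simps)
    have S: "P (Suc k) s * ?D = (\<delta> * P k s) * (- (q powi (int r + int p + 1 + int s)) * br (int k + 1) * br (int J - int k) * br (int M - int k))"
      unfolding P_Suc_br \<kappa>_def by (simp add: ac_simps)
    have AT: "\<alpha> s * P k s - \<theta>s k * P k s = (\<delta> * P k s) * 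
      (q powi (int p - int J + 2 * int s) * br (int r + int s + 1) * br (int M - int s)
      + q powi (int r - int M + 2 * int s) * br (int J - int s + 1) * br (int p + int s)
      + q powi (int M + int p - int J - int r - 1) + q powi (int J + int r + 1 - int M - int p)
      - q powi (int M + int J + int r + int p + 1 - 2 * int k) - q powi (2 * int k - int M - int J - int r - int p - 1))"
      unfolding \<alpha>_def \<theta>s_def by (simp add: algebra_simps)
    have rp': "int r = 0 \<or> int p = 0" using rp by auto
    have "P (Suc k) s * ?D = ?T * ?D + (\<alpha> s * P k s - \<theta>s k * P k s) * ?D + \<gamma> (Suc s) * P k (Suc s) * ?D"
      unfolding S T AT G three_term_identity[OF q0 rp', symmetric]
      by (simp add: distrib_left right_diff_distrib mult.assoc)
    also have "\<dots> = (?T + (\<alpha> s * P k s - \<theta>s k * P k s) + \<gamma> (Suc s) * P k (Suc s)) * ?D"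
      by (simp add: distrib_right)
    finally have "P (Suc k) s = ?T + (\<alpha> s * P k s - \<theta>s k * P k s) + \<gamma> (Suc s) * P k (Suc s)"
      using D by simp
    then show ?thesis by simp
  qed
  \<comment> \<open>\<open>P\<close> is defined beyond row \<open>d\<close>, and \<open>main\<close>
    at \<open>k = d\<close> mentions row \<open>d + 1\<close>. That row vanishes for
    \<open>s \<le> d\<close> because \<open>d\<close> equals \<open>J\<close> or \<open>M\<close>,
    which matches \<open>B\<close> sending \<open>m_d\<close> to a multiple of itself.\<close>
  have "P (Suc d) s = 0" if "s \<le> d" for s
  proof -
    have "br (int J - int d) * br (int M - int d) = 0" by (auto simp: d_def min_def)
    then have "P (Suc d) s * br (int d + 1 - int s) = 0" unfolding P_Suc_br by auto
    moreover have "br (int d + 1 - int s) \<noteq> 0" using that by (intro br_nz) auto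
    ultimately show ?thesis by simp
  qed
  then have CS: "P (Suc k) s = (if k < d then 1 * P (k + 1) s else 0)" if "k \<le> d" "s \<le> d" for k s
    using that by (auto simp: not_less)
  have \<gamma>: "\<gamma> (Suc s) * P k (Suc s) = (if s < d then \<gamma> (s + 1) * P k (s + 1) else 0)" if "k \<le> d" for k s
    using that by (auto simp: P_upper)
  show ?thesis
    unfolding VBop_eq_tridiag
  proof (rule row_comb_tridiag, unfold hths_eq)
    fix k s assume k: "k \<le> d" and s: "s \<le> d"
    show "\<theta>s k * P k s + (if k < d then 1 * P (k + 1) s else 0) + (if 0 < k then 0 * P (k - 1) s else 0)
      = \<alpha> s * P k s + (if 0 < s then \<beta> (s - 1) * P k (s - 1) else 0) + (if s < d then \<gamma> (s + 1) * P k (s + 1) else 0)"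
      unfolding CS[OF k s, symmetric] \<gamma>[OF k, of s, symmetric] main[OF k, of s, symmetric] by simp
  qed
qed

lemma bij_row_comb_P: "bij_betw (row_comb d P) (Vspace d) (Vspace d)"
  by (rule bij_betw_row_comb) (auto simp: P_upper P_diag_nz)

text \<open>A submodule is carried by \<open>row_comb d P\<close> to the basis \<open>u_s\<close>,
  where \<open>A\<close> is diagonal with distinct eigenvalues and \<open>B\<close> has nonzero
  off-diagonal entries; the conclusion is pulled back along this bijection.\<close>

lemma Vd_irreducible: "Vd_irreducible q a b c d"
  unfolding Vd_irreducible_def
proof (intro allI impI, elim conjE)
  fix U
  assume sub: "U \<subseteq> Vspace d" and z: "(\<lambda>_. 0) \<in> U"
    and add: "\<forall>y\<in>U. \<forall>z\<in>U. (\<lambda>k. y k + z k) \<in> U"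
    and scale: "\<forall>y\<in>U. \<forall>s. (\<lambda>k. s * y k) \<in> U"
    and ops: "\<forall>y\<in>U. VAop q a b c d y \<in> U \<and> VBop q a b c d y \<in> U \<and> VCop q a b c d y \<in> U"
  let ?G = "row_comb d P"
  have inj: "inj_on ?G (Vspace d)" using bij_row_comb_P by (rule bij_betw_imp_inj_on)
  have "Vsubspace d (?G ` U)"
    unfolding Vsubspace_def
  proof (intro conjI)
    show "?G ` U \<subseteq> Vspace d" using row_comb_in_Vspace by blast
    show "(\<lambda>_. 0) \<in> ?G ` U" by (rule image_eqI[OF _ z]) (simp add: row_comb_zero)
    show "\<forall>y\<in>?G ` U. \<forall>z\<in>?G ` U. (\<lambda>k. y k + z k) \<in> ?G ` U"
      using add by (auto simp: row_comb_add[symmetric])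
    show "\<forall>y\<in>?G ` U. \<forall>s. (\<lambda>k. s * y k) \<in> ?G ` U"
      using scale by (auto simp: row_comb_scale[symmetric])
  qed
  then have "?G ` U = {\<lambda>_. 0} \<or> ?G ` U = Vspace d"
  proof (rule tridiag_irreducible)
    show "A' x \<in> ?G ` U" if "x \<in> ?G ` U" for x
      using that ops by (auto simp: row_comb_VAop[symmetric])
    show "B' x \<in> ?G ` U" if "x \<in> ?G ` U" for x
      using that ops by (auto simp: row_comb_VBop[symmetric])
    show "inj_on \<theta> {..d}" by (rule inj_onI) (metis \<theta>_diff_nz right_minus_eq)
  qed (auto simp: \<beta>_nz \<gamma>_nz[unfolded Suc_eq_plus1[symmetric]])
  then show "U = {\<lambda>_. 0} \<or> U = Vspace d"
  proof
    assume 0: "?G ` U = {\<lambda>_. 0}"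
    have U0: "y = (\<lambda>_. 0)" if "y \<in> U" for y
    proof (rule inj_onD[OF inj])
      show "?G y = ?G (\<lambda>_. 0)" using 0 that by (auto simp: row_comb_zero)
    qed (use that z sub in auto)
    have "U \<subseteq> {\<lambda>_. 0}"
    proof
      fix y assume "y \<in> U"
      from U0[OF this] show "y \<in> {\<lambda>_. 0}" by (rule ssubst) (rule singletonI)
    qed
    then have "U = {\<lambda>_. 0}" using z by (intro equalityI) auto
    then show ?thesis ..
  next
    assume "?G ` U = Vspace d"
    also have "\<dots> = ?G ` Vspace d" by (rule bij_betw_imp_surj_on[OF bij_row_comb_P, symmetric])
    finally have "U = Vspace d" by (rule iffD1[OF inj_on_image_eq_iff[OF inj sub order_refl]])
    then show ?thesis ..
  qed
qed

section \<open>Coordinates on the weight space and the isomorphism\<close>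

definition W :: "tvec set" where
  "W = {x. \<forall>i j. x (i, j) \<noteq> 0 \<longrightarrow> i \<le> M + r \<and> j \<le> J + p \<and> i + j = J + r}"

definition coords :: "tvec \<Rightarrow> nat \<Rightarrow> complex" where
  "coords x = (\<lambda>s. if s \<le> d then x (r + s, J - s) else 0)"

text \<open>If \<open>r = 0\<close> then \<open>r \<le> i\<close> is trivial; if
  \<open>p = 0\<close> then \<open>j \<le> J\<close>, and \<open>i + j = J + r\<close> forces
  \<open>r \<le> i\<close>. Hence \<open>s = i - r\<close> involves no truncation.\<close>

lemma W_index_bounds:
  assumes "i \<le> M + r" "j \<le> J + p" "i + j = J + r"
  obtains s where "s \<le> d" "i = r + s" "j = J - s"
proof
  have "r \<le> i" using assms rp by auto
  then show "i = r + (i - r)" "j = J - (i - r)" using assms by auto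
  show "i - r \<le> d" using assms by (auto simp: d_def)
qed

lemma W_index: "s \<le> d \<Longrightarrow> r + s \<le> M + r \<and> J - s \<le> J + p \<and> r + s + (J - s) = J + r"
  by (auto simp: d_def)

lemma bij_coords: "bij_betw coords W (Vspace d)"
proof (rule bij_betw_byWitness)
  let ?h = "\<lambda>z (i, j). if i + j = J + r \<and> i \<le> M + r \<and> j \<le> J + p then z (i - r) else (0 :: complex)"
  show "\<forall>x\<in>W. ?h (coords x) = x"
  proof (intro ballI ext, clarify)
    fix x i j assume x: "x \<in> W"
    show "(if i + j = J + r \<and> i \<le> M + r \<and> j \<le> J + p then coords x (i - r) else 0) = x (i, j)"
    proof (cases "i + j = J + r \<and> i \<le> M + r \<and> j \<le> J + p")
      case True
      then obtain s where "s \<le> d" "i = r + s" "j = J - s" using W_index_bounds by metis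
      then show ?thesis using True by (auto simp: coords_def)
    next
      case False then show ?thesis using x by (auto simp: W_def)
    qed
  qed
  show "\<forall>z\<in>Vspace d. coords (?h z) = z"
    using W_index by (auto simp: coords_def Vspace_def fun_eq_iff)
  show "coords ` W \<subseteq> Vspace d" by (auto simp: coords_def Vspace_def)
  show "?h ` Vspace d \<subseteq> W" by (auto simp: W_def split: if_splits)
qed

text \<open>This formula and the ones for \<open>C\<close> and \<open>B\<close> hold for arbitrary
  \<open>x\<close>: the value at the index pair of \<open>u_s\<close> depends only on
  \<open>x\<close> at the index pairs of \<open>u_(s-1)\<close>, \<open>u_s\<close>,
  \<open>u_(s+1)\<close>.\<close>

lemma coords_HAop:
  "coords (HAop q (M + r) (J + p) \<delta> lam x) = A' (coords x)"
proof
  fix s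
  show "coords (HAop q (M + r) (J + p) \<delta> lam x) s = A' (coords x) s"
  proof (cases "s \<le> d")
    case True
    then have "s \<le> J" by (auto simp: d_def)
    then have e: "- (int (J + p) - 2 * int (J - s)) = int J - int p - 2 * int s" by simp
    have "coords (HAop q (M + r) (J + p) \<delta> lam x) s = \<theta> s * x (r + s, J - s)"
      using True W_index[OF True] unfolding coords_def HAop_apply[OF delta] e \<theta>_def by simp
    then show ?thesis using True by (simp add: coords_def tridiag_def)
  qed (simp add: coords_def tridiag_def)
qed

lemma coords_HCop:
  "coords (HCop q (M + r) (J + p) \<delta> lam x) = C' (coords x)"
proof
  fix s
  show "coords (HCop q (M + r) (J + p) \<delta> lam x) s = C' (coords x) s"
  proof (cases "s \<le> d")
    case True
    then have sJ: "s \<le> J" by (auto simp: d_def)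
    have 1: "- (int (M + r) - 2 * int (r + s)) = int r - int M + 2 * int s" by simp
    \<comment> \<open>The edges of the rectangle of indices translate into \<open>s < M\<close> and
      \<open>s < J\<close>, hence into \<open>s < d\<close>.\<close>
    have 2: "r + s < M + r \<and> 0 < J - s \<longleftrightarrow> s < d" using True by (auto simp: d_def)
    have 3: "q * q powi (- (int (J + p) - 2 * int (J - s - 1))) = q powi (int J - int p - 2 * int (s + 1) + 1)" if "s < d"
    proof -
      have "int (J - s - 1) = int J - int s - 1" using that by (auto simp: d_def)
      then show ?thesis
        using powi_add[of 1 "- (int (J + p) - 2 * int (J - s - 1))"] by (simp add: algebra_simps)
    qed
    have 4: "q * \<delta> * lam\<^sup>2 * q powi (- (int (J + p) - 2 * int (J - s - 1)))
            * qbr q (int (r + s) + 1) * qbr q (int (M + r) - int (r + s)) = - \<eta> (s + 1)" if "s < d"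
    proof -
      have "q * \<delta> * lam\<^sup>2 * q powi (- (int (J + p) - 2 * int (J - s - 1)))
          * qbr q (int (r + s) + 1) * qbr q (int (M + r) - int (r + s))
        = \<delta> * lam\<^sup>2 * (q * q powi (- (int (J + p) - 2 * int (J - s - 1))))
          * qbr q (int r + int (s + 1)) * qbr q (int M + 1 - int (s + 1))"
        by (simp add: ac_simps)
      then show ?thesis unfolding 3[OF that] \<eta>_def \<gamma>_def by (simp add: power2_eq_square ac_simps)
    qed
    have "coords (HCop q (M + r) (J + p) \<delta> lam x) s = \<epsilon> s * x (r + s, J - s)
        - (if s < d then - \<eta> (s + 1) * x (r + s + 1, J - s - 1) else 0)"
      using True W_index[OF True] 4
      unfolding coords_def HCop_apply[OF q0 qroot delta lam0] 1 2 \<epsilon>_def by simp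
    then show ?thesis using True by (simp add: coords_def tridiag_def)
  qed (simp add: coords_def tridiag_def)
qed

lemma coords_HBop:
  "coords (HBop q (M + r) (J + p) \<delta> lam x) = B' (coords x)"
proof
  fix s
  show "coords (HBop q (M + r) (J + p) \<delta> lam x) s = B' (coords x) s"
  proof (cases "s \<le> d")
    case True
    then have sJ: "s \<le> J" by (auto simp: d_def)
    have J_s: "int (J - s) = int J - int s" using sJ by simp
    have up: "r + s < M + r \<and> 0 < J - s \<longleftrightarrow> s < d" using True by (auto simp: d_def)
    \<comment> \<open>At \<open>s = 0\<close> the left side says \<open>0 < r\<close> and
      \<open>0 < p\<close>, which \<open>rp\<close> excludes.\<close>
    have dn: "0 < r + s \<and> J - s < J + p \<longleftrightarrow> 0 < s" using True sJ rp by auto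
    have "inverse q * q powi (int (M + r) - 2 * int (r + s)) * q powi (int (J + p) - 2 * int (J - s))
       = q powi (-1 + (int (M + r) - 2 * int (r + s)) + (int (J + p) - 2 * int (J - s)))"
      unfolding powi_add by simp
    also have "\<dots> = q powi (int M + int p - int J - int r - 1)"
      unfolding J_s by (simp add: algebra_simps)
    finally have e1: "inverse q * q powi (int (M + r) - 2 * int (r + s)) * q powi (int (J + p) - 2 * int (J - s)) = \<dots>" .
    have "q * q powi (- (int (M + r) - 2 * int (r + s))) * q powi (- (int (J + p) - 2 * int (J - s)))
       = q powi (1 + (- (int (M + r) - 2 * int (r + s))) + (- (int (J + p) - 2 * int (J - s))))"
      unfolding powi_add by simp
    also have "\<dots> = q powi (int J + int r + 1 - int M - int p)"
      unfolding J_s by (simp add: algebra_simps)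
    finally have e2: "q * q powi (- (int (M + r) - 2 * int (r + s))) * q powi (- (int (J + p) - 2 * int (J - s))) = \<dots>" .
    have e3: "int (J + p) - 2 * int (J - s) = int p - int J + 2 * int s"
      "- (int (M + r) - 2 * int (r + s)) = int r - int M + 2 * int s"
      "int (r + s) + 1 = int r + int s + 1" "int (M + r) - int (r + s) = int M - int s"
      "int (J - s) + 1 = int J - int s + 1" "int (J + p) - int (J - s) = int p + int s"
      unfolding J_s by auto
    have \<gamma>: "lam * br (int r + int s + 1) * br (int M - int s) = \<gamma> (s + 1)"
      by (simp add: \<gamma>_def algebra_simps)
    have \<beta>: "inverse lam * q powi (int r - int M + 2 * int s) * q powi (int (J + p) - 2 * int (J - s + 1))
            * br (int J - int s + 1) * br (int p + int s) = \<beta> (s - 1)" if "0 < s"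
    proof -
      have "q powi (int r - int M + 2 * int s) * q powi (int (J + p) - 2 * int (J - s + 1))
          = q powi (int p - int J - int M + int r + 4 * int (s - 1) + 2)"
        unfolding powi_add[symmetric] using that sJ by (simp add: algebra_simps)
      moreover have "int J - int s + 1 = int J - int (s - 1)" "int p + int s = int p + int (s - 1) + 1"
        using that by auto
      ultimately show ?thesis unfolding \<beta>_def by (simp only: mult.assoc)
    qed
    have "coords (HBop q (M + r) (J + p) \<delta> lam x) s = \<alpha> s * x (r + s, J - s)
        + (if s < d then \<gamma> (s + 1) * x (r + s + 1, J - s - 1) else 0)
        + (if 0 < s then \<beta> (s - 1) * x (r + s - 1, J - s + 1) else 0)"
      using True W_index[OF True] \<beta>
      unfolding coords_def HBop_apply[OF q0 qroot delta lam0] e1 e2 up dn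
      unfolding e3 \<gamma> \<alpha>_def by simp
    moreover have "x (r + s, J - s) = coords x s" using True by (simp add: coords_def)
    moreover have "x (r + s - 1, J - s + 1) = coords x (s - 1)" if "0 < s"
    proof -
      have "r + s - 1 = r + (s - 1)" "J - s + 1 = J - (s - 1)" "s - 1 \<le> d" using that sJ True by auto
      then show ?thesis by (simp add: coords_def)
    qed
    then have "(if 0 < s then \<beta> (s - 1) * x (r + s - 1, J - s + 1) else 0)
        = (if 0 < s then \<beta> (s - 1) * coords x (s - 1) else 0)" by simp
    moreover have "(if s < d then \<gamma> (s + 1) * x (r + s + 1, J - s - 1) else 0)
        = (if s < d then \<gamma> (s + 1) * coords x (s + 1) else 0)" by (simp add: coords_def)
    ultimately show ?thesis unfolding tridiag_def using True by (simp only: if_True ac_simps)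
  qed (simp add: coords_def tridiag_def)
qed

lemma Hq_iso_to_Vd:
  shows "Hq_iso_to_Vd q (M + r) (J + p) \<delta> lam W a b c d"
proof -
  let ?G = "row_comb d P"
  define f where "f = inv_into (Vspace d) ?G \<circ> coords"
  have inj: "inj_on ?G (Vspace d)" and im: "?G ` Vspace d = Vspace d"
    using bij_row_comb_P by (auto simp: bij_betw_def)
  have bij: "bij_betw f W (Vspace d)"
    unfolding f_def by (rule bij_betw_trans[OF bij_coords bij_betw_inv_into[OF bij_row_comb_P]])
  have coordsV: "coords x \<in> Vspace d" for x by (simp add: coords_def Vspace_def)
  have fV: "f x \<in> Vspace d" for x
    unfolding f_def comp_def by (rule inv_into_into) (simp add: im coordsV)
  have Gf: "?G (f x) = coords x" for x
    unfolding f_def comp_def by (rule f_inv_into_f[of _ ?G]) (simp add: im coordsV)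
  \<comment> \<open>\<open>f x\<close> is the only vector of \<open>Vspace d\<close> that
    \<open>?G\<close> sends to \<open>coords x\<close>, so each property of \<open>f\<close> is
    checked after applying \<open>?G\<close>.\<close>
  have fI: "f x = y" if "y \<in> Vspace d" "?G y = coords x" for x y
    by (rule inj_onD[OF inj]) (use that fV Gf in auto)
  have "f (\<lambda>p. x p + y p) = (\<lambda>k. f x k + f y k)" for x y
    by (rule fI) (use fV[of x] fV[of y] in \<open>auto simp: Vspace_def row_comb_add Gf coords_def\<close>)
  moreover have "f (\<lambda>p. t * x p) = (\<lambda>k. t * f x k)" for x t
    by (rule fI) (use fV[of x] in \<open>auto simp: Vspace_def row_comb_scale Gf coords_def\<close>)
  moreover have "f (HAop q (M + r) (J + p) \<delta> lam x) = VAop q a b c d (f x)" for x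
    by (rule fI) (simp_all add: row_comb_VAop Gf coords_HAop, simp add: VAop_eq_tridiag tridiag_in_Vspace)
  moreover have "f (HBop q (M + r) (J + p) \<delta> lam x) = VBop q a b c d (f x)" for x
    by (rule fI) (simp_all add: row_comb_VBop Gf coords_HBop, simp add: VBop_eq_tridiag tridiag_in_Vspace)
  moreover have "f (HCop q (M + r) (J + p) \<delta> lam x) = VCop q a b c d (f x)" for x
    by (rule fI) (simp_all add: row_comb_VCop Gf coords_HCop, simp add: VCop_eq_tridiag tridiag_in_Vspace)
  ultimately show ?thesis
    unfolding Hq_iso_to_Vd_def using bij by blast
qed

end

section \<open>The decomposition theorem\<close>

theorem mainTheorem12:
  fixes q \<delta> lam :: complex and m n :: nat
  assumes hq0: "q \<noteq> 0"
    and hqroot: "\<forall>k::nat. 0 < k \<longrightarrow> q ^ k \<noteq> 1"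
    and hdelta: "\<delta> = 1 \<or> \<delta> = -1"
    and hlam: "lam \<noteq> 0"
  defines "W \<equiv> (\<lambda>l::nat. K1K2_eigenspace q m n \<delta> lam
                   (\<delta> * q powi (int m + int n - 2 * int l)))"
  shows
    \<comment> \<open>(i) direct sum decomposition\<close>
    "(\<forall>x \<in> tens_space m n. \<exists>w. (\<forall>l\<le>m+n. w l \<in> W l)
          \<and> x = (\<lambda>p. \<Sum>l\<le>m+n. w l p))
     \<and> (\<forall>w. (\<forall>l\<le>m+n. w l \<in> W l) \<and> (\<lambda>p. \<Sum>l\<le>m+n. w l p) = (\<lambda>_. 0)
          \<longrightarrow> (\<forall>l\<le>m+n. w l = (\<lambda>_. 0)))
     \<comment> \<open>(i) each summand is an H_q-submodule\<close>
     \<and> (\<forall>l\<le>m+n. \<forall>x\<in>W l. HAop q m n \<delta> lam x \<in> W l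
          \<and> HBop q m n \<delta> lam x \<in> W l \<and> HCop q m n \<delta> lam x \<in> W l)
     \<comment> \<open>(ii) identification with the irreducible module V_d(a,b,c)\<close>
     \<and> (\<forall>l\<le>m+n.
          let a = \<delta> * lam * q powi (int l - int n - int (min m l) + int (min n l));
              b = \<delta> * q powi (int m + int n + int l - int (min m l) - int (min n l) + 1);
              c = lam * q powi (int l - int m - int (min n l) + int (min m l));
              d = min m l + min n l - l
          in Vd_irreducible q a b c d \<and> Hq_iso_to_Vd q m n \<delta> lam (W l) a b c d)"
proof (intro conjI)
  note h = hq0 hqroot hdelta hlam
  have W: "W l = {x. \<forall>i j. x (i, j) \<noteq> 0 \<longrightarrow> i \<le> m \<and> j \<le> n \<and> i + j = l}" for l
    unfolding W_def by (rule K1K2_eigenspace_eq[OF h])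
  show "\<forall>x \<in> tens_space m n. \<exists>w. (\<forall>l\<le>m+n. w l \<in> W l) \<and> x = (\<lambda>p. \<Sum>l\<le>m+n. w l p)"
  proof
    fix x assume x: "x \<in> tens_space m n"
    \<comment> \<open>The component of weight index \<open>l\<close> is the restriction of
      \<open>x\<close> to the antidiagonal \<open>i + j = l\<close>.\<close>
    define w where "w = (\<lambda>l (i, j). if i + j = l then x (i, j) else 0)"
    have xs: "i \<le> m \<and> j \<le> n" if "x (i, j) \<noteq> 0" for i j
      using x that unfolding tens_space_def by (auto simp: not_less[symmetric])
    have "w l \<in> W l" for l unfolding W using xs by (auto simp: w_def)
    moreover have "x (i, j) = (\<Sum>l\<le>m+n. w l (i, j))" for i j
    proof (cases "i + j \<le> m + n")
      case True then show ?thesis by (simp add: w_def)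
    next
      case False
      then have "x (i, j) = 0" using xs[of i j] by (metis add_mono)
      then show ?thesis by (simp add: w_def)
    qed
    ultimately show "\<exists>w. (\<forall>l\<le>m+n. w l \<in> W l) \<and> x = (\<lambda>p. \<Sum>l\<le>m+n. w l p)"
      by (intro exI[of _ w]) auto
  qed
  show "\<forall>w. (\<forall>l\<le>m+n. w l \<in> W l) \<and> (\<lambda>p. \<Sum>l\<le>m+n. w l p) = (\<lambda>_. 0)
          \<longrightarrow> (\<forall>l\<le>m+n. w l = (\<lambda>_. 0))"
  proof (intro allI impI, elim conjE)
    fix w l assume w: "\<forall>l\<le>m+n. w l \<in> W l" and s: "(\<lambda>p. \<Sum>l\<le>m+n. w l p) = (\<lambda>_. 0)" and l: "l \<le> m + n"
    have supp: "w l' (i, j) = 0" if "l' \<le> m + n" "i + j \<noteq> l'" for l' i j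
      using w that unfolding W by auto
    have "w l (i, j) = 0" for i j
    proof (cases "i + j = l")
      case True
      have "0 = (\<Sum>l'\<le>m+n. w l' (i, j))" using fun_cong[OF s, of "(i, j)"] by simp
      \<comment> \<open>Different weight spaces have disjoint supports, so only \<open>w l\<close>
        contributes at an index with \<open>i + j = l\<close>.\<close>
      also have "\<dots> = (\<Sum>l'\<in>{l}. w l' (i, j))"
        using l supp True by (intro sum.mono_neutral_right) auto
      finally show ?thesis by simp
    next
      case False then show ?thesis using supp[OF l] by simp
    qed
    then show "w l = (\<lambda>_. 0)" by auto
  qed
  show "\<forall>l\<le>m+n. \<forall>x\<in>W l. HAop q m n \<delta> lam x \<in> W l
          \<and> HBop q m n \<delta> lam x \<in> W l \<and> HCop q m n \<delta> lam x \<in> W l"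
    using weight_space_submodule[OF h W] by blast
  show "\<forall>l\<le>m+n.
          let a = \<delta> * lam * q powi (int l - int n - int (min m l) + int (min n l));
              b = \<delta> * q powi (int m + int n + int l - int (min m l) - int (min n l) + 1);
              c = lam * q powi (int l - int m - int (min n l) + int (min m l));
              d = min m l + min n l - l
          in Vd_irreducible q a b c d \<and> Hq_iso_to_Vd q m n \<delta> lam (W l) a b c d"
  proof (intro allI impI)
    fix l assume l: "l \<le> m + n"
    define J r p M where "J = min n l" "r = l - J" "p = n - J" "M = m - r"
    note defs = this
    \<comment> \<open>\<open>l \<le> m + n\<close> is what gives \<open>r \<le> m\<close>, so that
      \<open>m - r\<close> is not truncated.\<close>
    have eqs: "m = M + r" "n = J + p" "l = J + r" using l by (auto simp: defs)
    have rp: "r = 0 \<or> p = 0" unfolding defs by simp linarith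
    interpret T: hahn_tensor q \<delta> lam J M r p
      by (rule hahn_tensor.intro[OF h rp])
    have min_n: "min n l = J" by (simp add: defs(1))
    \<comment> \<open>Here \<open>m = M + r\<close> and \<open>l = J + r\<close>, so the minimum is
      \<open>r + min M J\<close>; this matches the stated parameters with those of the
      locale.\<close>
    have min_m: "min m l = r + T.d" unfolding T.d_def eqs by simp
    note mins = min_n min_m
    have a: "\<delta> * lam * q powi (int l - int n - int (min m l) + int (min n l)) = T.a"
      unfolding mins T.a_def by (simp add: eqs algebra_simps)
    have b: "\<delta> * q powi (int m + int n + int l - int (min m l) - int (min n l) + 1) = T.b"
      unfolding mins T.b_def by (simp add: eqs algebra_simps)
    have c: "lam * q powi (int l - int m - int (min n l) + int (min m l)) = T.c"
      unfolding mins T.c_def by (simp add: eqs algebra_simps)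
    have d: "min m l + min n l - l = T.d" unfolding mins by (simp add: eqs)
    have "W l = T.W" unfolding W T.W_def eqs ..
    then show "let a = \<delta> * lam * q powi (int l - int n - int (min m l) + int (min n l));
              b = \<delta> * q powi (int m + int n + int l - int (min m l) - int (min n l) + 1);
              c = lam * q powi (int l - int m - int (min n l) + int (min m l));
              d = min m l + min n l - l
          in Vd_irreducible q a b c d \<and> Hq_iso_to_Vd q m n \<delta> lam (W l) a b c d"
      unfolding Let_def a b c d using T.Vd_irreducible T.Hq_iso_to_Vd by (simp add: eqs(1,2)[symmetric])
  qed
qed

end
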